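(* Let $G$ be a finitely generated group with one end. Then there is a finite symmetric set of generators $S$ of $G$, not containing the identity, such that the Cayley graph $\mathrm{Cay}(G,S)$ is not minor excluded.
   Context: Cayley graph: for a group $G$ and a finite generating set $S$ that is symmetric ($s\in S$ iff $s^{-1}\in S$) and does not contain the identity, $\mathrm{Cay}(G,S)$ is the graph with vertex set $G$ in which $u,v\in G$ are adjacent if and only if $u=sv$ for some $s\in S$. Minor: a finite graph $M$ is a minor of a connected graph $\Gamma$ if there is a finite set $\{V_i\}$ of pairwise-disjoint (nonempty) finite connected subgraphs of $\Gamma$ (branch sets), in one-to-one correspondence with the set of vertices $\{v_i\}$ of $M$, such that for every edge of $M$ between $v_i$ and $v_j$ there is an edge of $\Gamma$ between $V_i$ and $V_j$. The graph $\Gamma$ is minor excluded if there is a finite graph that is not a minor of $\Gamma$; equivalently, if there is a natural number $m$ such that the complete graph $K_m$ is not a minor of $\Gamma$. Ends: for a connected, locally finite graph $\Gamma$ with a fixed vertex $O$, let $B(n,O)$ be the ball of radius $n$ centered at $O$. The number of ends of $\Gamma$ is the limit, as $n\to\infty$, of the number of unbounded connected components of $\Gamma\smallsetminus B(n,O)$. The number of ends of a finitely generated group is the number of ends of its Cayley graph with respect to any finite generating set (it does not depend on the generating set). *)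

theory Defs
  imports "HOL-Algebra.Generated_Groups" "Graph_Theory.Graph_Theory" "HOL-Library.Extended_Nat"
begin

text \<open>
  Simple undirected graphs are symmetric loop-free digraphs without parallel arcs, i.e. values of
  type \<^typ>\<open>'a pair_pre_digraph\<close> satisfying \<^locale>\<open>pair_bidirected_digraph\<close>, or
  \<^locale>\<open>pair_graph\<close> if they are also finite.
\<close>

section \<open>Cayley graphs\<close>

definition finitely_generated :: "('a, 'm) monoid_scheme \<Rightarrow> bool" where
  "finitely_generated G \<longleftrightarrow> (\<exists>T. finite T \<and> T \<subseteq> carrier G \<and> generate G T = carrier G)"

definition cayley_generators :: "('a, 'm) monoid_scheme \<Rightarrow> 'a set \<Rightarrow> bool" where
  "cayley_generators G S \<longleftrightarrow>
     finite S \<and> S \<subseteq> carrier G \<and> generate G S = carrier G \<and>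
     (\<forall>s\<in>carrier G. s \<in> S \<longleftrightarrow> inv\<^bsub>G\<^esub> s \<in> S) \<and> \<one>\<^bsub>G\<^esub> \<notin> S"

definition Cay :: "('a, 'm) monoid_scheme \<Rightarrow> 'a set \<Rightarrow> 'a pair_pre_digraph" where
  "Cay G S = \<lparr> pverts = carrier G,
     parcs = {(u, v). u \<in> carrier G \<and> v \<in> carrier G \<and> (\<exists>s\<in>S. u = s \<otimes>\<^bsub>G\<^esub> v)} \<rparr>"

lemma pair_bidirected_digraph_Cay:
  assumes "group G" and S: "cayley_generators G S"
  shows "pair_bidirected_digraph (Cay G S)"
proof -
  interpret group G by fact
  have sub: "S \<subseteq> carrier G" and one: "\<one>\<^bsub>G\<^esub> \<notin> S"
    and inv: "\<And>s. s \<in> S \<Longrightarrow> inv\<^bsub>G\<^esub> s \<in> S"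
    using S by (auto simp: cayley_generators_def)
  have sym: "\<exists>t\<in>S. v = t \<otimes>\<^bsub>G\<^esub> (s \<otimes>\<^bsub>G\<^esub> v)" if "s \<in> S" "v \<in> carrier G" for s v
    using that sub inv by (intro bexI[of _ "inv\<^bsub>G\<^esub> s"]) (auto simp: m_assoc[symmetric] subset_eq)
  show ?thesis
  proof
    show "symmetric (with_proj (Cay G S))"
      using sym by (auto simp: symmetric_def Cay_def intro!: symI)
    show "fst e \<noteq> snd e" if "e \<in> parcs (Cay G S)" for e
      using that one sub by (auto simp: Cay_def subset_eq)
  qed (auto simp: Cay_def)
qed


section \<open>Minors\<close>

definition is_minor :: "'b pair_pre_digraph \<Rightarrow> 'a pair_pre_digraph \<Rightarrow> bool" where
  "is_minor M \<Gamma> \<longleftrightarrow> (\<exists>B :: 'b \<Rightarrow> 'a pair_pre_digraph.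
     (\<forall>v\<in>pverts M. pair_graph (B v) \<and> subgraph (B v) \<Gamma> \<and> Digraph_Component.connected (B v)) \<and>
     (\<forall>v\<in>pverts M. \<forall>w\<in>pverts M. v \<noteq> w \<longrightarrow> pverts (B v) \<inter> pverts (B w) = {}) \<and>
     (\<forall>(v, w)\<in>parcs M. \<exists>x\<in>pverts (B v). \<exists>y\<in>pverts (B w). (x, y) \<in> parcs \<Gamma>))"

text \<open>
  Every finite graph is isomorphic to one with vertices in \<^typ>\<open>nat\<close>, so this restriction is
  harmless; see \<open>minor_excludedI\<close>.
\<close>

definition minor_excluded :: "'a pair_pre_digraph \<Rightarrow> bool" where
  "minor_excluded \<Gamma> \<longleftrightarrow> (\<exists>M :: nat pair_pre_digraph. pair_graph M \<and> \<not> is_minor M \<Gamma>)"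

lemma is_minor_embed:
  assumes "is_minor K \<Gamma>" and inj: "inj_on f (pverts M)" and "f ` pverts M \<subseteq> pverts K"
    and "\<And>v w. (v, w) \<in> parcs M \<Longrightarrow> (f v, f w) \<in> parcs K"
  shows "is_minor M \<Gamma>"
proof -
  from assms(1) obtain B where
    1: "\<And>v. v \<in> pverts K \<Longrightarrow> pair_graph (B v) \<and> subgraph (B v) \<Gamma> \<and> Digraph_Component.connected (B v)"
    and 2: "\<And>v w. \<lbrakk>v \<in> pverts K; w \<in> pverts K; v \<noteq> w\<rbrakk> \<Longrightarrow> pverts (B v) \<inter> pverts (B w) = {}"
    and 3: "\<And>v w. (v, w) \<in> parcs K \<Longrightarrow> \<exists>x\<in>pverts (B v). \<exists>y\<in>pverts (B w). (x, y) \<in> parcs \<Gamma>"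
    unfolding is_minor_def by fast
  show ?thesis
    unfolding is_minor_def
  proof (intro exI[of _ "B \<circ> f"] conjI ballI impI)
    fix v assume "v \<in> pverts M"
    then show "pair_graph ((B \<circ> f) v)" "subgraph ((B \<circ> f) v) \<Gamma>"
      "Digraph_Component.connected ((B \<circ> f) v)"
      using 1[of "f v"] assms(3) by auto
  next
    fix v w assume "v \<in> pverts M" "w \<in> pverts M" "v \<noteq> w"
    then show "pverts ((B \<circ> f) v) \<inter> pverts ((B \<circ> f) w) = {}"
      using 2[of "f v" "f w"] assms(3) inj_onD[OF inj, of v w] by auto
  next
    fix e assume "e \<in> parcs M"
    then show "case e of (v, w) \<Rightarrow>
        \<exists>x\<in>pverts ((B \<circ> f) v). \<exists>y\<in>pverts ((B \<circ> f) w). (x, y) \<in> parcs \<Gamma>"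
      using assms(4) 3 by (cases e) auto
  qed
qed

definition complete_nat :: "nat \<Rightarrow> nat pair_pre_digraph" where
  "complete_nat m = \<lparr> pverts = {..<m}, parcs = {(i, j). i < m \<and> j < m \<and> i \<noteq> j} \<rparr>"

lemma pair_graph_complete_nat: "pair_graph (complete_nat m)"
proof -
  have "finite {(i, j). i < m \<and> j < m \<and> i \<noteq> j}"
    by (rule finite_subset[of _ "{..<m} \<times> {..<m}"]) auto
  then show ?thesis
    by unfold_locales (auto simp: complete_nat_def symmetric_def sym_def)
qed

lemma not_is_minor_complete_nat:
  assumes "pair_graph M" "\<not> is_minor M \<Gamma>"
  shows "\<not> is_minor (complete_nat (card (pverts M))) \<Gamma>"
proof
  assume K: "is_minor (complete_nat (card (pverts M))) \<Gamma>"
  interpret M: pair_graph M by fact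
  obtain f where f: "bij_betw f (pverts M) {..<card (pverts M)}"
    using ex_bij_betw_finite_nat[OF M.pair_finite_verts] by (auto simp: atLeast0LessThan)
  have "(f v, f w) \<in> parcs (complete_nat (card (pverts M)))" if "(v, w) \<in> parcs M" for v w
  proof -
    have "v \<in> pverts M" "w \<in> pverts M" "v \<noteq> w"
      using M.arc_fst_in_verts[OF that] M.arc_snd_in_verts[OF that] M.pair_no_loops[OF that] by auto
    then show ?thesis
      using f by (auto simp: complete_nat_def bij_betw_def inj_on_def)
  qed
  then have "is_minor M \<Gamma>"
    using f by (intro is_minor_embed[OF K, of f]) (auto simp: bij_betw_def complete_nat_def)
  with assms show False by simp
qed

lemma minor_excluded_iff_complete: "minor_excluded \<Gamma> \<longleftrightarrow> (\<exists>m. \<not> is_minor (complete_nat m) \<Gamma>)"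
  unfolding minor_excluded_def using pair_graph_complete_nat not_is_minor_complete_nat by blast

lemma minor_excludedI: "pair_graph M \<Longrightarrow> \<not> is_minor M \<Gamma> \<Longrightarrow> minor_excluded \<Gamma>"
  unfolding minor_excluded_iff_complete using not_is_minor_complete_nat by blast


section \<open>Ends\<close>

definition graph_ball :: "'a pair_pre_digraph \<Rightarrow> nat \<Rightarrow> 'a \<Rightarrow> 'a set" where
  "graph_ball \<Gamma> n x = {y \<in> pverts \<Gamma>. wf_digraph.\<mu> \<Gamma> (\<lambda>_. 1) x y \<le> ereal (real n)}"

lemma graph_ball_awalk:
  assumes "pair_wf_digraph \<Gamma>"
  shows "graph_ball \<Gamma> n x = {y. \<exists>p. pre_digraph.awalk \<Gamma> x p y \<and> length p \<le> n}"
proof -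
  interpret pair_wf_digraph \<Gamma> by fact
  have cost: "awalk_cost (\<lambda>_. 1) p = real (length p)" for p :: "('a \<times> 'a) list"
    by (induct p) auto
  have "\<exists>p. awalk x p y \<and> length p \<le> n" if le: "\<mu> (\<lambda>_. 1) x y \<le> ereal (real n)" for y
  proof (rule ccontr)
    assume "\<not> ?thesis"
    then have "ereal (real (Suc n)) \<le> \<mu> (\<lambda>_. 1) x y"
      unfolding \<mu>_def by (intro INF_greatest) (auto simp: cost not_le)
    then have "ereal (real (Suc n)) \<le> ereal (real n)"
      using le by (rule order_trans)
    then show False by simp
  qed
  moreover have "\<mu> (\<lambda>_. 1) x y \<le> ereal (real n)" if "awalk x p y" "length p \<le> n" for p y
    using min_cost_le_walk_cost[OF that(1), of "\<lambda>_. 1"] that(2)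
    by (simp add: cost) (meson ereal_less_eq(3) of_nat_le_iff order_trans)
  ultimately show ?thesis
    by (auto simp: graph_ball_def)
qed

text \<open>
  On a symmetric digraph, the strongly connected components are the connected components.
\<close>

definition unbounded_components :: "'a pair_pre_digraph \<Rightarrow> 'a \<Rightarrow> nat \<Rightarrow> 'a set set" where
  "unbounded_components \<Gamma> x n =
     {C \<in> pre_digraph.sccs_verts (with_proj \<Gamma> \<restriction> (pverts \<Gamma> - graph_ball \<Gamma> n x)).
        \<forall>r. \<not> C \<subseteq> graph_ball \<Gamma> r x}"

definition has_ends :: "'a pair_pre_digraph \<Rightarrow> 'a \<Rightarrow> enat \<Rightarrow> bool" where
  "has_ends \<Gamma> x N \<longleftrightarrow>
     (\<lambda>n. if finite (unbounded_components \<Gamma> x n) then enat (card (unbounded_components \<Gamma> x n))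
          else \<infinity>) \<longlonglongrightarrow> N"

text \<open>
  The number of ends depends neither on the generating set nor, Cayley graphs being
  vertex-transitive, on the base vertex. As a hypothesis on a finitely generated group, the
  existential form is the weakest.
\<close>

definition group_has_ends :: "('a, 'm) monoid_scheme \<Rightarrow> enat \<Rightarrow> bool" where
  "group_has_ends G N \<longleftrightarrow> (\<exists>S. cayley_generators G S \<and> has_ends (Cay G S) \<one>\<^bsub>G\<^esub> N)"

end

theory Submission
  imports Defs
begin

text \<open>
  Let \<open>S\<close> be a generating set witnessing that the group has one end, and take all nontrivial
  elements of word length at most 3 as new generators. Vertices of even length and vertices of odd
  length are then two disjoint copies, at bounded distance, of the old Cayley graph.

  Since the group has one end, finite sets with bounded boundary have bounded size: a boundary of
  \<open>m\<close> points, translated to contain \<open>\<one>\<close>, misses one of \<open>m\<close> consecutive shells that are connected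
  in their middle, so the part of the boundary around \<open>\<one>\<close> can be removed at bounded cost. By
  Menger's theorem, for some \<open>r\<close> there are therefore \<open>k\<close> disjoint paths of even vertices from the
  ball of radius \<open>r\<close> to any distance. Every two of them are joined by a path of odd vertices
  inside a shell, and distinct pairs can use distinct shells. This gives a \<open>K\<^sub>k\<close> minor.
\<close>

section \<open>Menger's theorem\<close>

text \<open>Walks are nonempty vertex lists, so a common vertex of \<open>A\<close> and
  \<open>B\<close> is itself a walk. Vertices may repeat, since only disjointness of different walks
  matters.\<close>

definition walk_in :: "'a rel \<Rightarrow> 'a set \<Rightarrow> 'a set \<Rightarrow> 'a list \<Rightarrow> bool" where
  "walk_in E A B p \<longleftrightarrow> p \<noteq> [] \<and> successively (\<lambda>u v. (u, v) \<in> E) p \<and> hd p \<in> A \<and> last p \<in> B"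

definition separates :: "'a rel \<Rightarrow> 'a set \<Rightarrow> 'a set \<Rightarrow> 'a set \<Rightarrow> bool" where
  "separates E A B X \<longleftrightarrow> (\<forall>p. walk_in E A B p \<longrightarrow> set p \<inter> X \<noteq> {})"

lemma walk_in_mono: "walk_in E A B p \<Longrightarrow> E \<subseteq> E' \<Longrightarrow> A \<subseteq> A' \<Longrightarrow> B \<subseteq> B' \<Longrightarrow> walk_in E' A' B' p"
  unfolding walk_in_def by (metis (no_types, lifting) subsetD successively_mono)

lemma walk_in_join:
  assumes "walk_in E A {x} (p @ [x])" "walk_in E {x} B (x # q)"
  shows "walk_in E A B (p @ x # q)"
  using assms by (auto simp: walk_in_def successively_append_iff hd_append split: if_splits)

lemma walk_in_prefix:
  assumes "walk_in E A B (p @ x # q)" shows "walk_in E A {x} (p @ [x])"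
  using assms by (auto simp: walk_in_def successively_append_iff hd_append split: if_splits)

lemma walk_in_suffix:
  assumes "walk_in E A B (p @ x # q)" shows "walk_in E {x} B (x # q)"
  using assms by (auto simp: walk_in_def successively_append_iff)

text \<open>Using the edge \<open>(x, y)\<close> would put \<open>x\<close> at a position that has a
  successor, and only the final \<open>z\<close> has none. The mirrored version below argues with
  \<open>y\<close> and predecessors.\<close>

lemma successively_remove_edge:
  assumes "successively (\<lambda>u v. (u, v) \<in> E) (p @ [z])" "x \<notin> set p"
  shows "successively (\<lambda>u v. (u, v) \<in> E - {(x, y)}) (p @ [z])"
  using assms by (induction p) (auto simp: successively_Cons hd_append split: if_splits)

lemma successively_remove_edge':
  assumes "successively (\<lambda>u v. (u, v) \<in> E) (z # q)" "y \<notin> set q"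
  shows "successively (\<lambda>u v. (u, v) \<in> E - {(x, y)}) (z # q)"
  using assms by (induction q arbitrary: z) (auto simp: successively_Cons)

text \<open>Goering's proof: delete an edge \<open>(x, y)\<close>. If a small set \<open>X\<close> separates \<open>A\<close> from \<open>B\<close>
  afterwards, then the induction hypothesis applies to \<open>A\<close> and \<open>insert x X\<close> as well as to
  \<open>insert y X\<close> and \<open>B\<close>, and the two linkages fit together.\<close>

theorem menger:
  assumes "finite E"
    and "\<And>X. finite X \<Longrightarrow> separates E A B X \<Longrightarrow> k \<le> card X"
  shows "\<exists>P. (\<forall>i<k. walk_in E A B (P i)) \<and>
    (\<forall>i<k. \<forall>j<k. i \<noteq> j \<longrightarrow> set (P i) \<inter> set (P j) = {})"
  using assms
proof (induction E arbitrary: A B rule: finite_induct)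
  case empty
  \<comment> \<open>Without edges every walk is a single vertex.\<close>
  have sep: "separates {} A B (A \<inter> B)"
    unfolding separates_def
  proof (intro allI impI)
    fix p assume "walk_in {} A B p"
    then have "p \<noteq> []" "successively (\<lambda>u v. False) p" "hd p \<in> A" "last p \<in> B"
      by (auto simp: walk_in_def)
    then show "set p \<inter> (A \<inter> B) \<noteq> {}"
      by (cases p rule: list.exhaust; cases "tl p") auto
  qed
  have "\<exists>K\<subseteq>A \<inter> B. finite K \<and> card K = k"
  proof (cases "finite (A \<inter> B)")
    case True
    then show ?thesis
      using empty(1)[OF True sep] by (meson obtain_subset_with_card_n)
  next
    case False
    then show ?thesis by (meson infinite_arbitrarily_large)
  qed
  then obtain K where K: "K \<subseteq> A \<inter> B" "finite K" "card K = k" by blast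
  then obtain f where f: "bij_betw f {..<k} K"
    using ex_bij_betw_nat_finite[of K] by (auto simp: atLeast0LessThan)
  show ?case
    using f K by (intro exI[of _ "\<lambda>i. [f i]"]) (auto simp: walk_in_def bij_betw_def inj_on_def)
next
  case (insert e E)
  obtain x y where e: "e = (x, y)" by (cases e)
  let ?E = "insert e E"
  have E: "?E - {(x, y)} = E" using insert.hyps e by auto
  show ?case
  proof (cases "\<exists>X. finite X \<and> separates E A B X \<and> card X < k")
    case False
    then have "\<exists>P. (\<forall>i<k. walk_in E A B (P i)) \<and>
        (\<forall>i<k. \<forall>j<k. i \<noteq> j \<longrightarrow> set (P i) \<inter> set (P j) = {})"
      by (intro insert.IH) (meson not_le)
    then show ?thesis using walk_in_mono[of E A B _ ?E A B] by blast
  next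
    case True
    then obtain X where X: "finite X" "separates E A B X" "card X < k" by blast
    \<comment> \<open>Cut at the first vertex in \<open>insert x X\<close>. Since \<open>x\<close>
      does not occur before the cut, the initial piece survives the deletion of the edge.\<close>
    have first: "\<exists>r z s. p = r @ z # s \<and> z \<in> insert x X \<and> set r \<inter> insert x X = {} \<and>
        walk_in E A {z} (r @ [z])" if p: "walk_in ?E A B p" for p
    proof -
      have "set p \<inter> insert x X \<noteq> {}"
      proof
        assume *: "set p \<inter> insert x X = {}"
        have "successively (\<lambda>u v. (u, v) \<in> E) p"
          using p * successively_remove_edge[of ?E "butlast p" "last p" x y] E
          by (auto simp: walk_in_def dest: in_set_butlastD)
        then have "walk_in E A B p" using p by (auto simp: walk_in_def)
        then show False using X(2) * by (auto simp: separates_def)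
      qed
      then have "\<exists>z\<in>set p. z \<in> insert x X" by blast
      then obtain r z s where rs: "p = r @ z # s" "z \<in> insert x X" "\<forall>u\<in>set r. u \<notin> insert x X"
        using split_list_first_prop[of p "\<lambda>u. u \<in> insert x X"] by blast
      moreover have "walk_in E A {z} (r @ [z])"
        using walk_in_prefix[of ?E A B r z s] p rs successively_remove_edge[of ?E r z x y] E
        by (auto simp: walk_in_def)
      ultimately show ?thesis by blast
    qed
    \<comment> \<open>Dually, cut at the last vertex in \<open>insert y X\<close>: the final piece
      does not enter \<open>y\<close> again, so it avoids the deleted edge.\<close>
    have final: "\<exists>r z s. p = r @ z # s \<and> z \<in> insert y X \<and> set s \<inter> insert y X = {} \<and>
        walk_in E {z} B (z # s)" if p: "walk_in ?E A B p" for p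
    proof -
      have "set p \<inter> insert y X \<noteq> {}"
      proof
        assume *: "set p \<inter> insert y X = {}"
        have "successively (\<lambda>u v. (u, v) \<in> E) p"
          using p * successively_remove_edge'[of ?E "hd p" "tl p" y x] E
          by (cases p) (auto simp: walk_in_def)
        then have "walk_in E A B p" using p by (auto simp: walk_in_def)
        then show False using X(2) * by (auto simp: separates_def)
      qed
      then have "\<exists>z\<in>set p. z \<in> insert y X" by blast
      then obtain r z s where rs: "p = r @ z # s" "z \<in> insert y X" "\<forall>u\<in>set s. u \<notin> insert y X"
        using split_list_last_prop[of p "\<lambda>u. u \<in> insert y X"] by blast
      moreover have "walk_in E {z} B (z # s)"
        using walk_in_suffix[of ?E A B r z s] p rs successively_remove_edge'[of ?E z s y x] E
        by (auto simp: walk_in_def)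
      ultimately show ?thesis by blast
    qed
    have sepx: "separates ?E A B (insert x X)" and sepy: "separates ?E A B (insert y X)"
      using first final unfolding separates_def by fastforce+
    have "k \<le> card (insert x X)" "k \<le> card (insert y X)"
      using insert.prems sepx sepy X(1) by blast+
    \<comment> \<open>Both enlarged sets have at least \<open>k\<close> elements while
      \<open>X\<close> has fewer, so both insertions are proper and \<open>X\<close> has exactly
      \<open>k - 1\<close> elements.\<close>
    then have xX: "x \<notin> X" "y \<notin> X" and cX: "k = Suc (card X)"
      using X by (auto simp: card_insert_if split: if_splits)

    have "\<exists>P. (\<forall>i<k. walk_in E A (insert x X) (P i)) \<and>
      (\<forall>i<k. \<forall>j<k. i \<noteq> j \<longrightarrow> set (P i) \<inter> set (P j) = {})"
    proof (rule insert.IH)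
      fix T assume T: "finite T" "separates E A (insert x X) T"
      \<comment> \<open>Every \<open>?E\<close>-walk from \<open>A\<close> to \<open>B\<close>
        begins with an \<open>E\<close>-walk into \<open>insert x X\<close>, and \<open>T\<close>
        meets the latter.\<close>
      have "separates ?E A B T"
        unfolding separates_def
      proof (intro allI impI)
        fix p assume "walk_in ?E A B p"
        from first[OF this] obtain r z s where "p = r @ z # s" "z \<in> insert x X"
          "walk_in E A {z} (r @ [z])" by blast
        then show "set p \<inter> T \<noteq> {}"
          using T(2) walk_in_mono[of E A "{z}" "r @ [z]" E A "insert x X"]
          by (fastforce simp: separates_def)
      qed
      then show "k \<le> card T" using insert.prems T by blast
    qed
    then obtain P where P: "\<And>i. i < k \<Longrightarrow> walk_in E A (insert x X) (P i)"
      "\<And>i j. i < k \<Longrightarrow> j < k \<Longrightarrow> i \<noteq> j \<Longrightarrow> set (P i) \<inter> set (P j) = {}" by blast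
    have "\<exists>Q. (\<forall>i<k. walk_in E (insert y X) B (Q i)) \<and>
      (\<forall>i<k. \<forall>j<k. i \<noteq> j \<longrightarrow> set (Q i) \<inter> set (Q j) = {})"
    proof (rule insert.IH)
      fix T assume T: "finite T" "separates E (insert y X) B T"
      have "separates ?E A B T"
        unfolding separates_def
      proof (intro allI impI)
        fix p assume "walk_in ?E A B p"
        from final[OF this] obtain r z s where "p = r @ z # s" "z \<in> insert y X"
          "walk_in E {z} B (z # s)" by blast
        then show "set p \<inter> T \<noteq> {}"
          using T(2) walk_in_mono[of E "{z}" B "z # s" E "insert y X" B]
          by (fastforce simp: separates_def)
      qed
      then show "k \<le> card T" using insert.prems T by blast
    qed
    then obtain Q where Q: "\<And>i. i < k \<Longrightarrow> walk_in E (insert y X) B (Q i)"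
      "\<And>i j. i < k \<Longrightarrow> j < k \<Longrightarrow> i \<noteq> j \<Longrightarrow> set (Q i) \<inter> set (Q j) = {}" by blast

    have "\<exists>r z s. P i = r @ z # s \<and> z \<in> insert x X \<and> set r \<inter> insert x X = {} \<and>
        walk_in E A {z} (r @ [z])" if "i < k" for i
    proof -
      have "\<exists>z\<in>set (P i). z \<in> insert x X"
        using P(1)[OF that] by (metis walk_in_def last_in_set)
      then obtain r z s where "P i = r @ z # s" "z \<in> insert x X" "\<forall>u\<in>set r. u \<notin> insert x X"
        using split_list_first_prop[of "P i" "\<lambda>u. u \<in> insert x X"] by blast
      then show ?thesis using walk_in_prefix P(1)[OF that] by (metis disjoint_iff)
    qed
    then obtain a s r where a: "\<And>i. i < k \<Longrightarrow> P i = r i @ a i # s i \<and> a i \<in> insert x X \<and>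
        set (r i) \<inter> insert x X = {} \<and> walk_in E A {a i} (r i @ [a i])"
      by metis
    have "\<exists>r z s. Q i = r @ z # s \<and> z \<in> insert y X \<and> set s \<inter> insert y X = {} \<and>
        walk_in E {z} B (z # s)" if "i < k" for i
    proof -
      have "\<exists>z\<in>set (Q i). z \<in> insert y X"
        using Q(1)[OF that] by (metis walk_in_def hd_in_set)
      then obtain r z s where "Q i = r @ z # s" "z \<in> insert y X" "\<forall>u\<in>set s. u \<notin> insert y X"
        using split_list_last_prop[of "Q i" "\<lambda>u. u \<in> insert y X"] by blast
      then show ?thesis using walk_in_suffix Q(1)[OF that] by (metis disjoint_iff)
    qed
    then obtain b t q where b: "\<And>i. i < k \<Longrightarrow> Q i = q i @ b i # t i \<and> b i \<in> insert y X \<and>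
        set (t i) \<inter> insert y X = {} \<and> walk_in E {b i} B (b i # t i)"
      by metis
    have disjr: "set (r i @ [a i]) \<inter> set (r j @ [a j]) = {}" if "i < k" "j < k" "i \<noteq> j" for i j
      using P(2)[OF that] a[OF that(1)] a[OF that(2)] by auto
    have disjt: "set (b i # t i) \<inter> set (b j # t j) = {}" if "i < k" "j < k" "i \<noteq> j" for i j
      using Q(2)[OF that] b[OF that(1)] b[OF that(2)] by auto
    have "inj_on a {..<k}" using disjr by (fastforce simp: inj_on_def)
    \<comment> \<open>The \<open>k\<close> disjoint pieces end in distinct points of a set with
      \<open>k\<close> elements, so every point is hit exactly once.\<close>
    then have aim: "a ` {..<k} = insert x X"
      using a X(1) xX cX by (intro card_subset_eq) (auto simp: card_image)
    have "inj_on b {..<k}" using disjt by (fastforce simp: inj_on_def)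
    then have bim: "b ` {..<k} = insert y X"
      using b X(1) xX cX by (intro card_subset_eq) (auto simp: card_image)
    \<comment> \<open>A piece ending in \<open>X\<close> is continued by the final piece that starts
      there; the piece ending in \<open>x\<close> crosses the deleted edge and continues from
      \<open>y\<close>.\<close>
    define swap where "swap = (\<lambda>z. if z = x then y else z)"
    have "\<exists>j<k. b j = swap (a i)" if "i < k" for i
    proof -
      have "swap (a i) \<in> insert y X" using a[OF that] by (auto simp: swap_def)
      then show ?thesis using bim by (metis imageE lessThan_iff)
    qed
    then obtain \<pi> where \<pi>: "\<And>i. i < k \<Longrightarrow> \<pi> i < k \<and> b (\<pi> i) = swap (a i)" by metis
    have ainj: "i = j" if "i < k" "j < k" "a i = a j" for i j
      using \<open>inj_on a {..<k}\<close> that by (auto simp: inj_on_def)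
    have binj: "i = j" if "i < k" "j < k" "b i = b j" for i j
      using \<open>inj_on b {..<k}\<close> that by (auto simp: inj_on_def)
    have \<pi>inj: "i = j" if "i < k" "j < k" "\<pi> i = \<pi> j" for i j
    proof -
      have "swap (a i) = swap (a j)" using \<pi> that by metis
      then have "a i = a j"
        using a[OF that(1)] a[OF that(2)] xX by (auto simp: swap_def split: if_splits)
      then show ?thesis using ainj that by blast
    qed
    \<comment> \<open>Pieces meet only if they are to be glued. A common vertex outside
      \<open>X\<close> would yield an \<open>E\<close>-walk from \<open>A\<close> to
      \<open>B\<close> avoiding \<open>X\<close>; a common vertex in \<open>X\<close> is both
      \<open>a i\<close> and \<open>b j\<close>.\<close>
    have cross: "j = \<pi> i" if i: "i < k" and j: "j < k" and
      z: "z \<in> set (r i @ [a i])" "z \<in> set (b j # t j)" for i j z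
    proof (rule ccontr)
      assume ne: "j \<noteq> \<pi> i"
      then have bne: "b j \<noteq> swap (a i)" using \<pi>[OF i] binj[OF j, of "\<pi> i"] by auto
      obtain u v where u: "r i @ [a i] = u @ z # v" using z(1) by (metis split_list)
      obtain u' v' where u': "b j # t j = u' @ z # v'" using z(2) by (metis split_list)
      have w: "walk_in E A B (u @ z # v')"
        using walk_in_join walk_in_prefix walk_in_suffix a[OF i] b[OF j] u u' by metis
      have su: "set u \<subseteq> set (r i)" using u by (cases v rule: rev_cases) auto
      have sv: "set v' \<subseteq> set (t j)" using u' by (cases u') auto
      have "z \<notin> X"
      proof
        assume "z \<in> X"
        then have "z = a i" "z = b j" using z a[OF i] b[OF j] by auto
        then show False using bne \<open>z \<in> X\<close> xX by (auto simp: swap_def split: if_splits)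
      qed
      then show False
        using w X(2) su sv a[OF i] b[OF j] unfolding separates_def by fastforce
    qed
    \<comment> \<open>If \<open>a i\<close> differs from \<open>x\<close>, then
      \<open>b (\<pi> i)\<close> is \<open>a i\<close> itself and must not be repeated.\<close>
    define R where "R i = (r i @ [a i]) @
      (if a i = x then b (\<pi> i) # t (\<pi> i) else t (\<pi> i))" for i
    have setR: "set (R i) = set (r i @ [a i]) \<union> set (b (\<pi> i) # t (\<pi> i))" if "i < k" for i
      using \<pi>[OF that] by (auto simp: R_def swap_def)
    have "walk_in ?E A B (R i)" if i: "i < k" for i
    proof (cases "a i = x")
      case True
      then show ?thesis
        using a[OF i] b[of "\<pi> i"] \<pi>[OF i] e
        unfolding R_def walk_in_def swap_def
        by (auto simp: successively_append_iff hd_append elim!: successively_mono split: if_splits)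
    next
      case False
      then have "walk_in E A B (R i)"
        using walk_in_join[of E A "a i" "r i" B "t (\<pi> i)"] a[OF i] b[of "\<pi> i"] \<pi>[OF i]
        by (auto simp: R_def swap_def)
      then show ?thesis by (rule walk_in_mono) auto
    qed
    moreover have "set (R i) \<inter> set (R j) = {}" if "i < k" "j < k" "i \<noteq> j" for i j
    proof -
      have ne: "\<pi> i \<noteq> \<pi> j" and lt: "\<pi> i < k" "\<pi> j < k" using \<pi>inj \<pi> that by blast+
      have "set (r i @ [a i]) \<inter> set (b (\<pi> j) # t (\<pi> j)) = {}"
        using cross[OF that(1) lt(2)] ne by (metis disjoint_iff)
      moreover have "set (r j @ [a j]) \<inter> set (b (\<pi> i) # t (\<pi> i)) = {}"
        using cross[OF that(2) lt(1)] ne by (metis disjoint_iff)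
      ultimately show ?thesis
        using disjr[OF that] disjt[OF lt ne]
        unfolding setR[OF that(1)] setR[OF that(2)] by (simp only: Int_Un_distrib Int_Un_distrib2) blast
    qed
    ultimately show ?thesis by blast
  qed
qed

section \<open>Word length\<close>

locale cayley = group G for G (structure) +
  fixes S
  assumes cayley_generators: "cayley_generators G S"
begin

lemma S_carrier: "s \<in> S \<Longrightarrow> s \<in> carrier G"
  and S_inv: "s \<in> S \<Longrightarrow> inv s \<in> S"
  and finite_S: "finite S"
  and generate_S: "generate G S = carrier G"
  using cayley_generators by (auto simp: cayley_generators_def)

text \<open>Letters are multiplied on the left, in agreement with adjacency in
  \<open>Cay\<close>.\<close>

primrec word_ball :: "nat \<Rightarrow> 'a set" where
  "word_ball 0 = {\<one>}"
| "word_ball (Suc n) = word_ball n \<union> (\<lambda>(s, v). s \<otimes> v) ` (S \<times> word_ball n)"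

lemma word_ball_carrier: "word_ball n \<subseteq> carrier G"
  by (induction n) (auto dest: S_carrier)

lemma finite_word_ball: "finite (word_ball n)"
  by (induction n) (auto simp: finite_S)

lemma word_ball_mono: "n \<le> m \<Longrightarrow> word_ball n \<subseteq> word_ball m"
  by (induction m) (auto simp: le_Suc_eq)

lemma word_ball_mult: "a \<in> word_ball n \<Longrightarrow> b \<in> word_ball m \<Longrightarrow> a \<otimes> b \<in> word_ball (n + m)"
proof (induction n arbitrary: a)
  case 0
  then show ?case using word_ball_carrier[of m] by auto
next
  case (Suc n)
  show ?case
  proof (cases "a \<in> word_ball n")
    case True
    then show ?thesis using Suc by auto
  next
    case False
    then obtain s v where a: "a = s \<otimes> v" "s \<in> S" "v \<in> word_ball n" using Suc.prems by auto
    moreover have "s \<in> carrier G" "v \<in> carrier G" "b \<in> carrier G"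
      using a Suc.prems S_carrier word_ball_carrier by blast+
    ultimately have "a \<otimes> b = s \<otimes> (v \<otimes> b)" "v \<otimes> b \<in> word_ball (n + m)"
      using Suc m_assoc by auto
    then show ?thesis using a by auto
  qed
qed

lemma S_word_ball: "s \<in> S \<Longrightarrow> s \<in> word_ball (Suc 0)"
  using S_carrier by (force intro: image_eqI[of _ _ "(s, \<one>)"])

lemma word_ball_inv: "a \<in> word_ball n \<Longrightarrow> inv a \<in> word_ball n"
proof (induction n arbitrary: a)
  case (Suc n)
  show ?case
  proof (cases "a \<in> word_ball n")
    case True
    then show ?thesis using Suc by auto
  next
    case False
    then obtain s v where a: "a = s \<otimes> v" "s \<in> S" "v \<in> word_ball n" using Suc.prems by auto
    then have "inv a = inv v \<otimes> inv s"
      using inv_mult_group S_carrier word_ball_carrier by blast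
    then show ?thesis
      using word_ball_mult[OF Suc.IH[OF a(3)] S_word_ball[OF S_inv[OF a(2)]]] by auto
  qed
qed auto

lemma ex_word_ball: "g \<in> carrier G \<Longrightarrow> \<exists>n. g \<in> word_ball n"
proof -
  assume "g \<in> carrier G"
  then have "g \<in> generate G S" using generate_S by simp
  then show ?thesis
  proof (induction rule: generate.induct)
    case one
    show ?case by (rule exI[of _ 0]) simp
  next
    case (incl h)
    then show ?case using S_word_ball by blast
  next
    case (inv h)
    then show ?case using S_word_ball S_inv by blast
  next
    case (eng h1 h2)
    then show ?case using word_ball_mult by blast
  qed
qed

definition len :: "'a \<Rightarrow> nat" where
  "len g = (LEAST n. g \<in> word_ball n)"

lemma word_ball_iff: "g \<in> carrier G \<Longrightarrow> g \<in> word_ball n \<longleftrightarrow> len g \<le> n"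
  using ex_word_ball[of g] word_ball_mono[of "len g" n] LeastI_ex[of "\<lambda>n. g \<in> word_ball n"]
  by (auto simp: len_def intro: Least_le)

lemma finite_len_le: "finite {g \<in> carrier G. len g \<le> n}"
  using finite_word_ball[of n] by (rule finite_subset[rotated]) (auto simp: word_ball_iff)

lemma len_one: "len \<one> = 0"
  using word_ball_iff[of \<one> 0] by simp

lemma len_eq_0: "g \<in> carrier G \<Longrightarrow> len g = 0 \<Longrightarrow> g = \<one>"
  using word_ball_iff[of g 0] by simp

lemma len_mult: "a \<in> carrier G \<Longrightarrow> b \<in> carrier G \<Longrightarrow> len (a \<otimes> b) \<le> len a + len b"
  by (metis word_ball_iff word_ball_mult le_refl m_closed)

lemma len_inv: "a \<in> carrier G \<Longrightarrow> len (inv a) = len a"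
  by (metis word_ball_iff word_ball_inv le_refl inv_closed inv_inv le_antisym)

lemma len_S: "s \<in> S \<Longrightarrow> len s \<le> 1"
  using S_word_ball[of s] word_ball_iff[of s "Suc 0"] S_carrier[of s] by simp

text \<open>Strip the first letter of a shortest word; by subadditivity the remainder cannot be
  shorter than \<open>n\<close>. Every descent towards \<open>\<one>\<close> uses this step.\<close>

lemma len_Suc:
  assumes "g \<in> carrier G" "len g = Suc n"
  obtains s h where "s \<in> S" "h \<in> carrier G" "g = s \<otimes> h" "len h = n"
proof -
  have "g \<in> word_ball (Suc n)" "g \<notin> word_ball n" using assms word_ball_iff[of g "Suc n"] word_ball_iff[of g n] by (simp_all del: word_ball.simps)
  then obtain s h where sh: "s \<in> S" "h \<in> word_ball n" "g = s \<otimes> h" by auto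
  then have "h \<in> carrier G" "len h \<le> n" using word_ball_carrier word_ball_iff by blast+
  moreover have "len g \<le> 1 + len h"
    using sh len_mult[of s h] S_carrier len_S[of s] \<open>h \<in> carrier G\<close> by force
  ultimately show ?thesis using that[of s h] sh assms by auto
qed

lemma inv_mult_cancel: "x \<in> carrier G \<Longrightarrow> y \<in> carrier G \<Longrightarrow> inv x \<otimes> (x \<otimes> y) = y"
  and mult_inv_cancel: "x \<in> carrier G \<Longrightarrow> y \<in> carrier G \<Longrightarrow> x \<otimes> (inv x \<otimes> y) = y"
  by (simp_all flip: m_assoc)

section \<open>The word metric and its invariance\<close>

definition near :: "nat \<Rightarrow> 'a \<Rightarrow> 'a \<Rightarrow> bool" where
  "near k u v \<longleftrightarrow> u \<in> carrier G \<and> v \<in> carrier G \<and> len (u \<otimes> inv v) \<le> k"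

lemma near_refl: "u \<in> carrier G \<Longrightarrow> near k u u"
  by (simp add: near_def len_one)

lemma near_sym: "near k u v \<Longrightarrow> near k v u"
  unfolding near_def by (metis inv_closed inv_inv inv_mult_group len_inv m_closed)

lemma near_trans: "near k u v \<Longrightarrow> near l v w \<Longrightarrow> near (k + l) u w"
proof -
  assume *: "near k u v" "near l v w"
  then have "u \<otimes> inv w = (u \<otimes> inv v) \<otimes> (v \<otimes> inv w)"
    by (simp add: near_def m_assoc inv_mult_cancel)
  then show ?thesis
    using * len_mult[of "u \<otimes> inv v" "v \<otimes> inv w"] by (auto simp: near_def)
qed

lemma near_mono: "near k u v \<Longrightarrow> k \<le> l \<Longrightarrow> near l u v"
  by (auto simp: near_def)

lemma near_len: "near k u v \<Longrightarrow> len u \<le> len v + k"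
  using len_mult[of "u \<otimes> inv v" v] by (auto simp: near_def m_assoc)

lemma near_S: "s \<in> S \<Longrightarrow> v \<in> carrier G \<Longrightarrow> near 1 (s \<otimes> v) v"
  using len_S S_carrier by (auto simp: near_def m_assoc)

text \<open>The factor \<open>x\<close> cancels in \<open>u \<otimes> inv v\<close>, so right
  multiplications are isometries.\<close>

lemma near_right_mult:
  "near k u v \<Longrightarrow> x \<in> carrier G \<Longrightarrow> near k (u \<otimes> x) (v \<otimes> x)"
  by (auto simp: near_def inv_mult_group m_assoc mult_inv_cancel)

text \<open>The ball around \<open>v\<close> is a right translate of the ball around
  \<open>\<one>\<close>; hence the bound in \<open>card_near\<close> is uniform in
  \<open>v\<close>.\<close>

lemma near_subset: "{u. near k u v} \<subseteq> (\<lambda>g. g \<otimes> v) ` word_ball k"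
proof
  fix u assume "u \<in> {u. near k u v}"
  then show "u \<in> (\<lambda>g. g \<otimes> v) ` word_ball k"
    by (intro image_eqI[of _ _ "u \<otimes> inv v"]) (auto simp: near_def m_assoc word_ball_iff)
qed

lemma finite_near: "finite {u. near k u v}"
  using near_subset finite_word_ball by (meson finite_imageI finite_subset)

lemma card_near: "card {u. near k u v} \<le> card (word_ball k)"
  using near_subset finite_word_ball by (rule surj_card_le[rotated])

lemma near_one_iff: "near 1 u v \<longleftrightarrow> u \<in> carrier G \<and> v \<in> carrier G \<and> (u = v \<or> (\<exists>s\<in>S. u = s \<otimes> v))"
proof
  assume *: "near 1 u v"
  then have "u \<otimes> inv v \<in> word_ball (Suc 0)"
    using word_ball_iff[of "u \<otimes> inv v" "Suc 0"] by (simp add: near_def del: word_ball.simps)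
  then have "u \<otimes> inv v = \<one> \<or> u \<otimes> inv v \<in> S" using S_carrier by auto
  moreover have "u = (u \<otimes> inv v) \<otimes> v" using * by (auto simp: near_def m_assoc)
  ultimately show "u \<in> carrier G \<and> v \<in> carrier G \<and> (u = v \<or> (\<exists>s\<in>S. u = s \<otimes> v))"
    using * by (auto simp: near_def)
qed (use near_S near_refl in auto)

section \<open>Generators of bounded word length\<close>

definition ball_generators :: "nat \<Rightarrow> 'a set" where
  "ball_generators k = word_ball k - {\<one>}"

lemma cayley_generators_ball:
  assumes "1 \<le> k" shows "cayley_generators G (ball_generators k)"
proof -
  have "S \<subseteq> ball_generators k"
    using S_word_ball word_ball_mono[of 1 k] assms cayley_generators
    by (auto simp: ball_generators_def cayley_generators_def)
  then have "carrier G \<subseteq> generate G (ball_generators k)"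
    using generate_S mono_generate by metis
  moreover have "ball_generators k \<subseteq> carrier G"
    using word_ball_carrier by (auto simp: ball_generators_def)
  moreover have "inv s \<in> ball_generators k" if "s \<in> ball_generators k" for s
    using that word_ball_inv[of s k] word_ball_carrier[of k] inv_eq_1_iff[of s]
    unfolding ball_generators_def by blast
  then have "s \<in> ball_generators k \<longleftrightarrow> inv s \<in> ball_generators k" if "s \<in> carrier G" for s
    using that by (metis inv_inv)
  ultimately show ?thesis
    using generate_incl[of "ball_generators k"] finite_word_ball[of k]
    unfolding cayley_generators_def by (auto simp: ball_generators_def)
qed

text \<open>The only candidate for a generator taking \<open>v\<close> to \<open>u\<close> is
  \<open>u \<otimes> inv v\<close>. The new graph is thus the \<open>k\<close>-th power of the old
  one.\<close>

lemma parcs_Cay_ball: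
  "(u, v) \<in> parcs (Cay G (ball_generators k)) \<longleftrightarrow> near k u v \<and> u \<noteq> v"
proof
  assume "(u, v) \<in> parcs (Cay G (ball_generators k))"
  then obtain s where s: "u \<in> carrier G" "v \<in> carrier G" "s \<in> word_ball k" "s \<noteq> \<one>" "u = s \<otimes> v"
    by (auto simp: Cay_def ball_generators_def)
  moreover have "s \<in> carrier G" using s word_ball_carrier by blast
  ultimately show "near k u v \<and> u \<noteq> v"
    by (auto simp: near_def m_assoc word_ball_iff)
next
  assume *: "near k u v \<and> u \<noteq> v"
  then have "u = (u \<otimes> inv v) \<otimes> v" "v = \<one> \<otimes> v" by (auto simp: near_def m_assoc)
  then have "u \<otimes> inv v \<noteq> \<one>" using * by metis
  then show "(u, v) \<in> parcs (Cay G (ball_generators k))"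
    using * by (auto simp: near_def Cay_def ball_generators_def word_ball_iff m_assoc
        intro!: bexI[of _ "u \<otimes> inv v"])
qed

section \<open>Balls of the Cayley graph\<close>

lemma pair_wf_Cay: "pair_wf_digraph (Cay G S)"
  by unfold_locales (auto simp: Cay_def)

text \<open>Length changes by at most one along an arc, and a shortest word spells a walk to
  \<open>\<one>\<close> with one arc per letter.\<close>

lemma graph_ball_Cay: "graph_ball (Cay G S) n \<one> = word_ball n"
proof -
  interpret C: pair_sym_digraph "Cay G S"
    using pair_bidirected_digraph_Cay[OF is_group cayley_generators]
    by (simp add: pair_bidirected_digraph_def)
  have V: "pverts (Cay G S) = carrier G" by (simp add: Cay_def)
  have 1: "C.awalk x p y \<Longrightarrow> len x \<le> length p + len y \<and> len y \<le> length p + len x" for x p y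
  proof (induction p arbitrary: x)
    case Nil
    then show ?case by (auto simp: C.awalk_Nil_iff)
  next
    case (Cons e p)
    then have w: "C.awalk (snd e) p y" and "e \<in> parcs (Cay G S)" "fst e = x"
      by (auto simp: C.awalk_Cons_iff)
    then have "near 1 x (snd e)" by (auto simp: Cay_def near_one_iff simp del: One_nat_def)
    then have "len x \<le> len (snd e) + 1" "len (snd e) \<le> len x + 1" using near_len near_sym by blast+
    then show ?case using Cons.IH[OF w] by auto
  qed
  have 2: "\<exists>p. C.awalk x p \<one> \<and> length p = n" if "x \<in> carrier G" "len x = n" for x n
    using that
  proof (induction n arbitrary: x)
    case 0
    then show ?case using len_eq_0[of x] V by (auto simp: C.awalk_Nil_iff)
  next
    case (Suc n)
    then obtain s h where sh: "s \<in> S" "h \<in> carrier G" "x = s \<otimes> h" "len h = n" using len_Suc by metis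
    then obtain p where "C.awalk h p \<one>" "length p = n" using Suc.IH by blast
    moreover have "(x, h) \<in> parcs (Cay G S)" using sh Suc.prems by (auto simp: Cay_def)
    ultimately show ?case by (intro exI[of _ "(x, h) # p"]) (simp add: C.awalk_Cons_iff)
  qed
  \<comment> \<open>Descent produces walks to \<open>\<one>\<close>, whereas the ball is described
    by walks from it; arcs are symmetric, so reversal helps.\<close>
  have 3: "\<exists>p. C.awalk \<one> p x \<and> length p = len x" if x: "x \<in> carrier G" for x
  proof -
    obtain p where p: "C.awalk x p \<one>" "length p = len x" using 2[OF x refl] by blast
    have "length (rev_path q) = length q" for q :: "('a \<times> 'a) list" by (induction q) auto
    then show ?thesis using p(2) C.awalk_rev_path'[OF p(1)] by (intro exI[of _ "rev_path p"]) simp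
  qed
  show ?thesis
    unfolding graph_ball_awalk[OF pair_wf_Cay]
  proof safe
    fix y p assume *: "C.awalk \<one> p y" "length p \<le> n"
    then have "y \<in> carrier G" using C.awalk_last_in_verts[OF *(1)] V by simp
    then show "y \<in> word_ball n" using 1[OF *(1)] *(2) len_one by (simp add: word_ball_iff)
  next
    fix y assume y: "y \<in> word_ball n"
    then have "y \<in> carrier G" using word_ball_carrier by blast
    then show "\<exists>p. C.awalk \<one> p y \<and> length p \<le> n"
      using 3[of y] word_ball_iff[of y n] y by auto
  qed
qed

end

section \<open>Ends and isoperimetry\<close>

context cayley
begin

section \<open>Connectivity outside a ball\<close>

definition outer :: "nat \<Rightarrow> 'a rel" where
  "outer n = {(u, v). near 1 u v \<and> n < len u \<and> n < len v}"

definition shell :: "nat \<Rightarrow> nat \<Rightarrow> 'a rel" where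
  "shell n m = {(u, v) \<in> outer n. len u \<le> m \<and> len v \<le> m}"

lemma pverts_Cay: "pverts (Cay G S) = carrier G"
  by (simp add: Cay_def)

lemma parcs_Cay: "(u, v) \<in> parcs (Cay G S) \<longleftrightarrow> near 1 u v \<and> u \<noteq> v"
proof -
  have "s \<otimes> v \<noteq> v" if "s \<in> S" "v \<in> carrier G" for s
  proof
    assume "s \<otimes> v = v"
    then have "s = \<one>" using that S_carrier r_cancel_one by blast
    then show False using that cayley_generators by (auto simp: cayley_generators_def)
  qed
  then show ?thesis unfolding near_one_iff by (auto simp: Cay_def)
qed

lemma sym_outer: "sym (outer n)"
  by (auto simp: outer_def intro!: symI near_sym)

lemma outer_mono: "n \<le> m \<Longrightarrow> outer m \<subseteq> outer n"
  by (auto simp: outer_def)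

lemma shell_mono: "m \<le> m' \<Longrightarrow> shell n m \<subseteq> shell n m'"
  by (auto simp: shell_def)

lemma outer_rtranclD:
  "(u, v) \<in> (outer n)\<^sup>* \<Longrightarrow> u \<in> carrier G \<Longrightarrow> n < len u \<Longrightarrow> v \<in> carrier G \<and> n < len v"
  by (induction rule: rtrancl_induct) (auto simp: outer_def near_def)

text \<open>A path has finitely many vertices, so their lengths are bounded.\<close>

lemma outer_rtrancl_shell:
  assumes "(u, v) \<in> (outer n)\<^sup>*" shows "\<exists>m. (u, v) \<in> (shell n m)\<^sup>*"
  using assms
proof (induction rule: rtrancl_induct)
  case (step v w)
  then obtain m where m: "(u, v) \<in> (shell n m)\<^sup>*" by blast
  define m' where "m' = max m (max (len v) (len w))"
  have "(u, v) \<in> (shell n m')\<^sup>*"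
    using m rtrancl_mono[OF shell_mono[of m m' n]] by (auto simp: m'_def)
  moreover have "(v, w) \<in> shell n m'" using step.hyps by (auto simp: shell_def m'_def)
  ultimately show ?case by (meson rtrancl.rtrancl_into_rtrancl)
qed blast

abbreviation outer_graph :: "nat \<Rightarrow> ('a, 'a \<times> 'a) pre_digraph" where
  "outer_graph n \<equiv> with_proj (Cay G S) \<restriction> (pverts (Cay G S) - graph_ball (Cay G S) n \<one>)"

lemma reachable_outer_graph:
  "u \<rightarrow>\<^sup>*\<^bsub>outer_graph n\<^esub> v \<longleftrightarrow> u \<in> carrier G \<and> n < len u \<and> (u, v) \<in> (outer n)\<^sup>*"
proof -
  have V: "verts (outer_graph n) = {u \<in> carrier G. n < len u}"
    by (auto simp: graph_ball_Cay word_ball_iff pverts_Cay)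
  have A: "arcs_ends (outer_graph n) = {(u, v). (u, v) \<in> parcs (Cay G S) \<and> (u, v) \<in> outer n}"
    by (auto simp: arcs_ends_def arc_to_ends_def graph_ball_Cay pverts_Cay parcs_Cay word_ball_iff
        outer_def near_def)
  show ?thesis
  proof safe
    assume "u \<rightarrow>\<^sup>*\<^bsub>outer_graph n\<^esub> v"
    then have r: "(u, v) \<in> rtrancl_on {u \<in> carrier G. n < len u} (arcs_ends (outer_graph n))"
      unfolding reachable_def V .
    then have "u \<in> {u \<in> carrier G. n < len u} \<and> (u, v) \<in> (outer n)\<^sup>*"
      by (induction rule: rtrancl_on_induct) (auto simp: A intro: rtrancl.rtrancl_into_rtrancl)
    then show "u \<in> carrier G" "n < len u" "(u, v) \<in> (outer n)\<^sup>*" by auto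
  next
    assume u: "u \<in> carrier G" "n < len u" and r: "(u, v) \<in> (outer n)\<^sup>*"
    have "(u, v) \<in> rtrancl_on {u \<in> carrier G. n < len u} (arcs_ends (outer_graph n))"
      using r
    proof (induction rule: rtrancl_induct)
      case base
      then show ?case using u by simp
    next
      case (step v w)
      show ?case
      \<comment> \<open>\<open>outer\<close> contains loops and the Cayley graph does not; such
        steps are simply dropped.\<close>
      proof (cases "v = w")
        case True
        then show ?thesis using step.IH by simp
      next
        case False
        then have "(v, w) \<in> arcs_ends (outer_graph n)" "w \<in> carrier G" "n < len w"
          using step.hyps by (auto simp: A outer_def near_def parcs_Cay)
        then show ?thesis using step.IH by (blast intro: rtrancl_on_into_rtrancl_on)
      qed
    qed
    then show "u \<rightarrow>\<^sup>*\<^bsub>outer_graph n\<^esub> v" unfolding reachable_def V .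
  qed
qed

text \<open>As \<open>outer n\<close> is symmetric, its reachability classes are strongly connected,
  and they are maximal by construction.\<close>

lemma component_in_sccs_verts:
  assumes "x \<in> carrier G" "n < len x"
  shows "{y. (x, y) \<in> (outer n)\<^sup>*} \<in> pre_digraph.sccs_verts (outer_graph n)"
proof -
  have s: "(v, u) \<in> (outer n)\<^sup>*" if "(u, v) \<in> (outer n)\<^sup>*" for u v
    using that sym_outer sym_rtrancl by (meson symD)
  have t: "(u, v) \<in> (outer n)\<^sup>*" if "(x, u) \<in> (outer n)\<^sup>*" "(x, v) \<in> (outer n)\<^sup>*" for u v
    using s that rtrancl_trans by metis
  show ?thesis
    unfolding pre_digraph.sccs_verts_def reachable_outer_graph
    using assms outer_rtranclD by (auto intro: t dest: rtrancl_trans)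
qed

text \<open>Descend along a shortest word and stop at length \<open>Suc n\<close>, before the path
  enters the ball.\<close>

lemma ex_sphere_below:
  assumes "x \<in> carrier G" "n < len x"
  shows "\<exists>y \<in> carrier G. len y = Suc n \<and> (x, y) \<in> (outer n)\<^sup>*"
  using assms
proof (induction "len x" arbitrary: x)
  case (Suc k)
  show ?case
  proof (cases "k = n")
    case True
    then show ?thesis using Suc by auto
  next
    case False
    obtain s h where sh: "s \<in> S" "h \<in> carrier G" "x = s \<otimes> h" "len h = k"
      using len_Suc[of x k] Suc by auto
    then obtain y where y: "y \<in> carrier G" "len y = Suc n" "(h, y) \<in> (outer n)\<^sup>*"
      using Suc.hyps(1)[of h] Suc.hyps(2) Suc.prems False by auto
    moreover have "(x, h) \<in> outer n"
      using near_S[of s h] sh Suc False by (auto simp: outer_def)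
    ultimately show ?thesis by (meson converse_rtrancl_into_rtrancl)
  qed
qed simp

text \<open>An unbounded component exists, so lengths are unbounded. Every component outside a ball
  meets the finite sphere around it, so the bounded components all lie in one larger ball, and
  beyond that only the unique unbounded component remains.\<close>

lemma one_end_connected:
  assumes "has_ends (Cay G S) \<one> 1"
  shows "\<exists>g\<in>carrier G. r < len g"
    and "\<exists>a. \<forall>x\<in>carrier G. \<forall>y\<in>carrier G. a < len x \<longrightarrow> a < len y \<longrightarrow> (x, y) \<in> (outer n)\<^sup>*"
proof -
  let ?U = "unbounded_components (Cay G S) \<one>"
  let ?f = "\<lambda>n. if finite (?U n) then enat (card (?U n)) else \<infinity>"
  have lim: "?f \<longlonglongrightarrow> 1" using assms by (simp add: has_ends_def)
  have "(1::enat) < 2" by (simp add: one_enat_def numeral_eq_enat)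
  \<comment> \<open>The only extended natural number strictly between 0 and 2 is 1, so convergence
    makes the count eventually exactly 1.\<close>
  then have "\<forall>\<^sub>F n in sequentially. 0 < ?f n \<and> ?f n < 2"
    using order_tendstoD[OF lim, of 0] order_tendstoD(2)[OF lim, of 2]
    by (intro eventually_conj) auto
  then obtain n0 where "\<And>n. n0 \<le> n \<Longrightarrow> 0 < ?f n \<and> ?f n < 2"
    by (auto simp: eventually_sequentially)
  then have card1: "card (?U n) = 1" if "n0 \<le> n" for n
    using that by (force simp: numeral_eq_enat zero_enat_def split: if_splits)
  show "\<exists>g\<in>carrier G. r < len g"
  proof -
    obtain C where C: "C \<in> ?U n0"
      using card1[of n0] by (metis card.empty ex_in_conv le_refl zero_neq_one)
    then obtain g where g: "g \<in> C" "g \<notin> word_ball r"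
      by (auto simp: unbounded_components_def graph_ball_Cay)
    moreover have "g \<rightarrow>\<^sup>*\<^bsub>outer_graph n0\<^esub> g"
      using C g by (auto simp: unbounded_components_def pre_digraph.sccs_verts_def)
    ultimately show ?thesis using reachable_outer_graph word_ball_iff by (meson not_le)
  qed
  \<comment> \<open>At radius \<open>k\<close> the unbounded component is unique, and paths outside
    this ball also avoid the ball of radius \<open>n\<close>.\<close>
  define k where "k = max n n0"
  obtain C where C: "?U k = {C}"
    using card1[of k] by (auto simp: k_def card_1_singleton_iff)
  define comp where "comp x = {y. (x, y) \<in> (outer k)\<^sup>*}" for x
  have "\<exists>b. comp y \<subseteq> word_ball b \<or> comp y = C" if "y \<in> carrier G" "len y = Suc k" for y
  proof (rule ccontr)
    assume *: "\<not> ?thesis"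
    have "comp y \<in> ?U k"
      unfolding unbounded_components_def
    proof (intro CollectI conjI allI)
      show "comp y \<in> pre_digraph.sccs_verts (outer_graph k)"
        unfolding comp_def using component_in_sccs_verts[of y k] that by simp
      show "\<not> comp y \<subseteq> graph_ball (Cay G S) r \<one>" for r
        using * by (simp add: graph_ball_Cay)
    qed
    then show False using * C by blast
  qed
  then obtain b where b: "\<And>y. y \<in> carrier G \<Longrightarrow> len y = Suc k \<Longrightarrow> comp y \<subseteq> word_ball (b y) \<or> comp y = C"
    by metis
  define Y where "Y = {y \<in> carrier G. len y = Suc k}"
  have finY: "finite Y"
    using finite_len_le[of "Suc k"] by (rule finite_subset[rotated]) (auto simp: Y_def)
  \<comment> \<open>The sum serves as a common upper bound of all \<open>b y\<close>.\<close>
  define a where "a = k + (\<Sum>y\<in>Y. b y)"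
  have inC: "x \<in> C \<and> comp x = C" if x: "x \<in> carrier G" "a < len x" for x
  proof -
    obtain y where y: "y \<in> carrier G" "len y = Suc k" "(x, y) \<in> (outer k)\<^sup>*"
      using ex_sphere_below[of x k] x by (auto simp: a_def)
    then have yx: "(y, x) \<in> (outer k)\<^sup>*" using sym_rtrancl[OF sym_outer] by (meson symD)
    have "b y \<le> a" using y finY member_le_sum[of y Y b] by (auto simp: a_def Y_def)
    then have "x \<notin> word_ball (b y)" using x word_ball_iff by auto
    moreover have "x \<in> comp y" using yx by (simp add: comp_def)
    ultimately have "comp y = C" using b y by blast
    moreover have "comp x = comp y" using y yx by (auto simp: comp_def intro: rtrancl_trans)
    ultimately show ?thesis using \<open>x \<in> comp y\<close> by simp
  qed
  have "(x, y) \<in> (outer n)\<^sup>*" if "x \<in> carrier G" "y \<in> carrier G" "a < len x" "a < len y" for x y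
  proof -
    have "y \<in> comp x" using inC that by blast
    then show ?thesis using rtrancl_mono[OF outer_mono[of n k]] by (auto simp: comp_def k_def)
  qed
  then show "\<exists>a. \<forall>x\<in>carrier G. \<forall>y\<in>carrier G. a < len x \<longrightarrow> a < len y \<longrightarrow> (x, y) \<in> (outer n)\<^sup>*"
    by blast
qed

end

locale one_ended_cayley = cayley +
  assumes one_end: "has_ends (Cay G S) \<one> 1"
begin

lemma ex_len: "\<exists>g\<in>carrier G. len g = n"
proof (cases n)
  case 0
  then show ?thesis using len_one by blast
next
  case (Suc k)
  then show ?thesis using one_end_connected(1)[OF one_end, of k] ex_sphere_below by metis
qed

text \<open>The window of lengths above \<open>a\<close> and up to \<open>a + 3\<close> has finitely
  many pairs, so their connecting paths share an outer radius \<open>m\<close>. Its width is three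
  so that walks with steps of size at most 3 cannot jump over it.\<close>

lemma ex_shell:
  "\<exists>a m. n \<le> a \<and> a + 3 \<le> m \<and> (\<forall>x\<in>carrier G. \<forall>y\<in>carrier G. a < len x \<longrightarrow> len x \<le> a + 3 \<longrightarrow>
     a < len y \<longrightarrow> len y \<le> a + 3 \<longrightarrow> (x, y) \<in> (shell n m)\<^sup>*)"
proof -
  obtain a0 where a0: "\<forall>x\<in>carrier G. \<forall>y\<in>carrier G. a0 < len x \<longrightarrow> a0 < len y \<longrightarrow> (x, y) \<in> (outer n)\<^sup>*"
    using one_end_connected(2)[OF one_end] by blast
  define a where "a = max n a0"
  define X where "X = {x \<in> carrier G. a < len x \<and> len x \<le> a + 3}"
  have "finite X"
    using finite_len_le[of "a + 3"] by (rule finite_subset[rotated]) (auto simp: X_def)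
  have "\<exists>m. (x, y) \<in> (shell n m)\<^sup>*" if "x \<in> X" "y \<in> X" for x y
    using a0 that by (intro outer_rtrancl_shell) (auto simp: X_def a_def)
  then obtain f where f: "\<And>x y. x \<in> X \<Longrightarrow> y \<in> X \<Longrightarrow> (x, y) \<in> (shell n (f x y))\<^sup>*" by metis
  define m where "m = a + 3 + (\<Sum>(x, y)\<in>X \<times> X. f x y)"
  have "(x, y) \<in> (shell n m)\<^sup>*" if "x \<in> X" "y \<in> X" for x y
  proof -
    have "f x y \<le> m"
      using that \<open>finite X\<close> member_le_sum[of "(x, y)" "X \<times> X" "\<lambda>(x, y). f x y"] by (auto simp: m_def)
    then show ?thesis using f[OF that] rtrancl_mono[OF shell_mono] by blast
  qed
  then have "n \<le> a \<and> a + 3 \<le> m \<and> (\<forall>x\<in>carrier G. \<forall>y\<in>carrier G. a < len x \<longrightarrow> len x \<le> a + 3 \<longrightarrow>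
     a < len y \<longrightarrow> len y \<le> a + 3 \<longrightarrow> (x, y) \<in> (shell n m)\<^sup>*)"
    by (auto simp: X_def m_def a_def)
  then show ?thesis by blast
qed

section \<open>Inner vertex boundaries and isoperimetry\<close>

definition bdry :: "'a set \<Rightarrow> 'a set" where
  "bdry F = {v \<in> F. \<exists>w. near 1 v w \<and> w \<notin> F}"

text \<open>A nonempty set without boundary is closed under left multiplication by generators, hence
  is the whole group, which is infinite because all lengths occur.\<close>

lemma bdry_empty:
  assumes "finite F" "F \<subseteq> carrier G" "bdry F = {}" shows "F = {}"
proof (rule ccontr)
  assume "F \<noteq> {}"
  then obtain v where v: "v \<in> F" by blast
  have mult: "h \<otimes> v \<in> F" if "h \<in> carrier G" for h
    using that
  proof (induction "len h" arbitrary: h)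
    case 0
    then show ?case using v assms(2) len_eq_0[of h] by auto
  next
    case (Suc n)
    then obtain s k where sk: "s \<in> S" "k \<in> carrier G" "h = s \<otimes> k" "len k = n"
      using len_Suc[of h n] by metis
    then have "k \<otimes> v \<in> F" using Suc by simp
    moreover have "h \<otimes> v = s \<otimes> (k \<otimes> v)" using sk v assms(2) S_carrier by (simp add: m_assoc subsetD)
    moreover have "k \<otimes> v \<in> carrier G" using \<open>k \<otimes> v \<in> F\<close> assms by blast
    ultimately show ?case
      using near_sym[OF near_S[OF sk(1), of "k \<otimes> v"]] assms(3) unfolding bdry_def by auto
  qed
  have "carrier G \<subseteq> F"
  proof
    fix g assume "g \<in> carrier G"
    then show "g \<in> F" using mult[of "g \<otimes> inv v"] v assms(2) by (auto simp: m_assoc)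
  qed
  then have "finite (carrier G)" using assms(1) finite_subset by blast
  moreover obtain g where "g \<in> carrier G" "len g = Suc (Max (len ` carrier G))" using ex_len by blast
  ultimately show False by (metis Max_ge finite_imageI imageI not_less_eq_eq order_refl)
qed

text \<open>Right translations are automorphisms of the Cayley graph.\<close>

lemma bdry_translate:
  assumes "F \<subseteq> carrier G" "x \<in> carrier G"
  shows "bdry ((\<lambda>g. g \<otimes> x) ` F) = (\<lambda>g. g \<otimes> x) ` bdry F"
proof -
  have inj: "g \<in> F" if "g \<otimes> x \<in> (\<lambda>g. g \<otimes> x) ` F" "g \<in> carrier G" for g
    using that assms by (auto simp: subset_eq)
  show ?thesis
  proof safe
    fix v assume "v \<in> bdry ((\<lambda>g. g \<otimes> x) ` F)"
    then obtain g w where g: "v = g \<otimes> x" "g \<in> F" "near 1 (g \<otimes> x) w" "w \<notin> (\<lambda>g. g \<otimes> x) ` F"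
      by (auto simp: bdry_def)
    then have w: "w \<in> carrier G" by (simp add: near_def)
    have "near 1 (g \<otimes> x \<otimes> inv x) (w \<otimes> inv x)"
      using near_right_mult[OF g(3), of "inv x"] assms by simp
    moreover have "g \<otimes> x \<otimes> inv x = g" using g assms by (auto simp: m_assoc subset_eq)
    moreover have "w = w \<otimes> inv x \<otimes> x" using w assms by (simp add: m_assoc)
    ultimately have "g \<in> bdry F" using g unfolding bdry_def by auto
    then show "v \<in> (\<lambda>g. g \<otimes> x) ` bdry F" using g by blast
  next
    fix g assume "g \<in> bdry F"
    then obtain w where w: "g \<in> F" "near 1 g w" "w \<notin> F" by (auto simp: bdry_def)
    then have "w \<otimes> x \<notin> (\<lambda>g. g \<otimes> x) ` F" using inj[of w] unfolding near_def by blast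
    then show "g \<otimes> x \<in> bdry ((\<lambda>g. g \<otimes> x) ` F)"
      using w near_right_mult[OF w(2) assms(2)] by (auto simp: bdry_def)
  qed
qed

text \<open>A path can leave \<open>F\<close> only from a boundary point, and here the shell has
  none.\<close>

lemma shell_avoid:
  assumes "(x, y) \<in> (shell n m)\<^sup>*" "x \<in> F" "\<And>b. b \<in> bdry F \<Longrightarrow> \<not> (n < len b \<and> len b \<le> m)"
  shows "y \<in> F"
  using assms(1,2)
proof (induction rule: rtrancl_induct)
  case (step v w)
  then show ?case using assms(3)[of v] by (auto simp: shell_def outer_def bdry_def)
qed

text \<open>Some shell contains no boundary point, so its middle sphere lies inside or outside of \<open>F\<close>.
  Accordingly, filling or emptying the ball bounded by this sphere removes \<open>\<one>\<close> from the
  boundary and adds no point to it.\<close>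

lemma reduce_bdry:
  "\<exists>K. \<forall>F. finite F \<longrightarrow> F \<subseteq> carrier G \<longrightarrow> \<one> \<in> bdry F \<longrightarrow> card (bdry F) \<le> Suc m \<longrightarrow>
     (\<exists>F'. finite F' \<and> F' \<subseteq> carrier G \<and> card (bdry F') \<le> m \<and> card F \<le> card F' + K)"
proof -
  obtain A M where AM: "\<And>n. n \<le> A n \<and> A n + 3 \<le> M n"
    "\<And>n x y. x \<in> carrier G \<Longrightarrow> y \<in> carrier G \<Longrightarrow> A n < len x \<Longrightarrow> len x \<le> A n + 3 \<Longrightarrow>
      A n < len y \<Longrightarrow> len y \<le> A n + 3 \<Longrightarrow> (x, y) \<in> (shell n (M n))\<^sup>*"
    using ex_shell by metis
  \<comment> \<open>Successive radii: the shells between \<open>r i\<close> and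
    \<open>r (Suc i)\<close> are pairwise disjoint.\<close>
  define r where "r i = (M ^^ i) 0" for i
  have rS: "r (Suc i) = M (r i)" for i by (simp add: r_def)
  have "mono r" using AM(1) by (intro mono_iff_le_Suc[THEN iffD2] allI) (simp add: rS, metis add_leD1 le_trans)
  show ?thesis
  \<comment> \<open>Emptying a ball of radius at most \<open>r (Suc m)\<close> loses no more points
    than this, whatever \<open>F\<close> is.\<close>
  proof (intro exI[of _ "card (word_ball (r (Suc m)))"] allI impI)
    fix F assume F: "finite F" "F \<subseteq> carrier G" "\<one> \<in> bdry F" "card (bdry F) \<le> Suc m"
    have finb: "finite (bdry F)" using F(1) by (simp add: bdry_def)
    have cardb: "card (bdry F - {\<one>}) \<le> m" using F(3,4) finb by simp
    \<comment> \<open>Pigeonhole: there are \<open>Suc m\<close> shells and at most \<open>m\<close>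
      boundary points besides \<open>\<one>\<close>, whose length 0 keeps it out of every
      shell.\<close>
    have "\<exists>i\<le>m. \<forall>b\<in>bdry F. \<not> (r i < len b \<and> len b \<le> r (Suc i))"
    proof (rule ccontr)
      assume "\<not> ?thesis"
      then have "\<forall>i\<le>m. \<exists>b\<in>bdry F. r i < len b \<and> len b \<le> r (Suc i)" by blast
      then obtain b where b: "\<And>i. i \<le> m \<Longrightarrow> b i \<in> bdry F \<and> r i < len (b i) \<and> len (b i) \<le> r (Suc i)"
        by metis
      have "b i \<noteq> b j" if "i < j" "i \<le> m" "j \<le> m" for i j
        using b[of i] b[of j] monoD[OF \<open>mono r\<close>, of "Suc i" j] that by auto
      then have "inj_on b {..m}" by (intro linorder_inj_onI') auto
      moreover have "b ` {..m} \<subseteq> bdry F - {\<one>}" using b len_one by fastforce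
      ultimately have "card {..m} \<le> card (bdry F - {\<one>})"
        using finb by (intro card_inj_on_le[of b]) auto
      then show False using cardb by simp
    qed
    then obtain i where i: "i \<le> m" "\<And>b. b \<in> bdry F \<Longrightarrow> \<not> (r i < len b \<and> len b \<le> M (r i))"
      by (auto simp: rS)
    \<comment> \<open>The innermost sphere of the window, any two points of which are connected
      within the shell.\<close>
    define R where "R = Suc (A (r i))"
    have R: "r i < R" "R \<le> r (Suc m)"
      using AM(1)[of "r i"] monoD[OF \<open>mono r\<close>, of "Suc i" "Suc m"] i(1) by (auto simp: R_def rS)
    have sphere: "y \<in> F" if "x \<in> F" "y \<in> carrier G" "len x = R" "len y = R" for x y
      using shell_avoid[OF AM(2)[of x y "r i"]] i(2) that F(2) by (auto simp: R_def)
    have cardR: "card {g \<in> carrier G. len g \<le> R} \<le> card (word_ball (r (Suc m)))"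
      using R(2) by (intro card_mono finite_word_ball) (auto simp: word_ball_iff)
    have len1: "near 1 v w \<Longrightarrow> len v \<le> len w + 1 \<and> len w \<le> len v + 1" for v w
      using near_len near_sym by blast
    show "\<exists>F'. finite F' \<and> F' \<subseteq> carrier G \<and> card (bdry F') \<le> m \<and>
      card F \<le> card F' + card (word_ball (r (Suc m)))"
    proof (cases "\<exists>x\<in>F. len x = R")
      case True
      \<comment> \<open>Filling: a boundary point of \<open>F'\<close> outside \<open>F\<close>
        would have length \<open>R\<close>, but that sphere lies in \<open>F\<close>.\<close>
      define F' where "F' = F \<union> {g \<in> carrier G. len g \<le> R}"
      have fin': "finite F'" using F(1) finite_len_le by (simp add: F'_def)
      have "bdry F' \<subseteq> bdry F - {\<one>}"
      proof
        fix v assume "v \<in> bdry F'"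
        then obtain w where w: "v \<in> F'" "near 1 v w" "w \<notin> F'" by (auto simp: bdry_def)
        then have "w \<notin> F" "R < len w" by (auto simp: F'_def near_def)
        moreover have "v \<in> F"
        proof (rule ccontr)
          assume "v \<notin> F"
          then have "v \<in> carrier G" "len v = R" using w \<open>R < len w\<close> len1[OF w(2)] by (auto simp: F'_def)
          then show False using True sphere \<open>v \<notin> F\<close> by blast
        qed
        moreover have "v \<noteq> \<one>" using len1[OF w(2)] \<open>R < len w\<close> R(1) len_one by auto
        ultimately show "v \<in> bdry F - {\<one>}" using w by (auto simp: bdry_def)
      qed
      then have "card (bdry F') \<le> m" using cardb finb card_mono[of "bdry F - {\<one>}" "bdry F'"] by auto
      moreover have "card F \<le> card F'" using fin' by (intro card_mono) (auto simp: F'_def)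
      ultimately show ?thesis using fin' F(2) by (intro exI[of _ F']) (auto simp: F'_def)
    next
      case False
      \<comment> \<open>Emptying: a neighbour in \<open>F\<close> that was removed would have length
        \<open>R\<close>, but \<open>F\<close> misses that sphere.\<close>
      define F' where "F' = {g \<in> F. R < len g}"
      have "bdry F' \<subseteq> bdry F - {\<one>}"
      proof
        fix v assume "v \<in> bdry F'"
        then obtain w where w: "v \<in> F" "R < len v" "near 1 v w" "w \<notin> F \<or> len w \<le> R"
          by (auto simp: bdry_def F'_def)
        moreover have "w \<notin> F" using w len1[OF w(3)] False by (metis Suc_eq_plus1 le_antisym less_Suc_eq_le order_less_le_trans)
        ultimately show "v \<in> bdry F - {\<one>}" using len_one by (auto simp: bdry_def)
      qed
      then have "card (bdry F') \<le> m" using cardb finb card_mono[of "bdry F - {\<one>}" "bdry F'"] by auto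
      moreover have "card F \<le> card F' + card {g \<in> carrier G. len g \<le> R}"
      proof -
        have "card F \<le> card (F' \<union> {g \<in> carrier G. len g \<le> R})"
          using F(1,2) finite_len_le by (intro card_mono) (auto simp: F'_def)
        also have "\<dots> \<le> card F' + card {g \<in> carrier G. len g \<le> R}" by (rule card_Un_le)
        finally show ?thesis .
      qed
      ultimately show ?thesis using F(1,2) cardR by (intro exI[of _ F']) (auto simp: F'_def)
    qed
  qed
qed

text \<open>Induction on the boundary size: translate a boundary point to \<open>\<one>\<close> and
  remove it by \<open>reduce_bdry\<close>, at a cost independent of the set.\<close>

lemma card_le_of_bdry:
  "\<exists>N. \<forall>F. finite F \<longrightarrow> F \<subseteq> carrier G \<longrightarrow> card (bdry F) \<le> m \<longrightarrow> card F \<le> N"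
proof (induction m)
  case 0
  have "card F \<le> 0" if "finite F" "F \<subseteq> carrier G" "card (bdry F) \<le> 0" for F
    using that bdry_empty[of F] by (simp add: bdry_def)
  then show ?case by blast
next
  case (Suc m)
  then obtain N where N: "\<And>F. finite F \<Longrightarrow> F \<subseteq> carrier G \<Longrightarrow> card (bdry F) \<le> m \<Longrightarrow> card F \<le> N"
    by blast
  obtain K where K: "\<And>F. finite F \<Longrightarrow> F \<subseteq> carrier G \<Longrightarrow> \<one> \<in> bdry F \<Longrightarrow> card (bdry F) \<le> Suc m \<Longrightarrow>
     \<exists>F'. finite F' \<and> F' \<subseteq> carrier G \<and> card (bdry F') \<le> m \<and> card F \<le> card F' + K"
    using reduce_bdry by metis
  have "card F \<le> N + K" if F: "finite F" "F \<subseteq> carrier G" "card (bdry F) \<le> Suc m" for F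
  proof (cases "bdry F = {}")
    case True
    then have "F = {}" using bdry_empty F by blast
    then show ?thesis by simp
  next
    case False
    then obtain v where v: "v \<in> bdry F" by blast
    then have vc: "v \<in> carrier G" using F(2) by (auto simp: bdry_def)
    define T where "T = (\<lambda>g. g \<otimes> inv v)"
    have inj: "inj_on T (carrier G)" using vc by (auto simp: T_def inj_on_def)
    have bd: "bdry (T ` F) = T ` bdry F" using bdry_translate[OF F(2), of "inv v"] vc by (simp add: T_def)
    have one: "\<one> \<in> bdry (T ` F)" using bd v vc by (force simp: T_def)
    have "bdry F \<subseteq> F" by (auto simp: bdry_def)
    then have "card (bdry (T ` F)) \<le> Suc m"
      using F inj inj_on_subset unfolding bd by (metis card_image order_trans)
    moreover have "T ` F \<subseteq> carrier G" using F(2) vc by (auto simp: T_def)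
    ultimately obtain F' where "finite F'" "F' \<subseteq> carrier G" "card (bdry F') \<le> m"
      "card (T ` F) \<le> card F' + K"
      using K[of "T ` F"] one F(1) by blast
    moreover have "card (T ` F) = card F" using F(2) inj inj_on_subset card_image by blast
    ultimately show ?thesis using N[of F'] by simp
  qed
  then show ?case by blast
qed

end

section \<open>Complete minors\<close>

text \<open>Paths must stay inside \<open>U\<close>, so this is connectivity of the induced
  subgraph. The empty set qualifies, whence nonemptiness is demanded separately of branch
  sets.\<close>

definition conn :: "'a rel \<Rightarrow> 'a set \<Rightarrow> bool" where
  "conn E U \<longleftrightarrow> (\<forall>u\<in>U. \<forall>v\<in>U. (u, v) \<in> (E \<inter> U \<times> U)\<^sup>*)"

lemma conn_singleton: "conn E {x}"
  by (simp add: conn_def)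

lemma conn_Un:
  assumes "sym E" "conn E U" "conn E V" "u \<in> U" "v \<in> V" "(u, v) \<in> E"
  shows "conn E (U \<union> V)"
proof -
  let ?R = "(E \<inter> (U \<union> V) \<times> (U \<union> V))\<^sup>*"
  have U: "(a, b) \<in> ?R" if "a \<in> U" "b \<in> U" for a b
    using assms(2) that rtrancl_mono[of "E \<inter> U \<times> U" "E \<inter> (U \<union> V) \<times> (U \<union> V)"]
    by (auto simp: conn_def)
  have V: "(a, b) \<in> ?R" if "a \<in> V" "b \<in> V" for a b
    using assms(3) that rtrancl_mono[of "E \<inter> V \<times> V" "E \<inter> (U \<union> V) \<times> (U \<union> V)"]
    by (auto simp: conn_def)
  have "(u, v) \<in> ?R" "(v, u) \<in> ?R"
    using assms by (auto intro!: r_into_rtrancl dest: symD)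
  then have "(a, b) \<in> ?R" "(b, a) \<in> ?R" if "a \<in> U" "b \<in> V" for a b
    using U V assms(4,5) that rtrancl_trans by metis+
  then show ?thesis using U V by (auto simp: conn_def)
qed

text \<open>Attach the sets one at a time to the common core \<open>U\<close>.\<close>

lemma conn_UN:
  assumes "finite J" "sym E" "conn E U"
    and "\<And>j. j \<in> J \<Longrightarrow> conn E (V j) \<and> (\<exists>u\<in>U. \<exists>v\<in>V j. (u, v) \<in> E)"
  shows "conn E (U \<union> (\<Union>j\<in>J. V j))"
  using assms(1,4)
proof (induction J)
  case empty
  then show ?case using assms(3) by simp
next
  case (insert j J)
  then obtain u v where "u \<in> U" "v \<in> V j" "(u, v) \<in> E" by blast
  then have "conn E ((U \<union> (\<Union>j\<in>J. V j)) \<union> V j)"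
    using insert.IH insert.prems conn_Un[OF assms(2), of "U \<union> (\<Union>j\<in>J. V j)" "V j" u v] by auto
  then show ?case by (simp add: Un_ac)
qed

lemma conn_walk: "sym E \<Longrightarrow> successively (\<lambda>u v. (u, v) \<in> E) p \<Longrightarrow> conn E (set p)"
proof (induction p)
  case (Cons x p)
  show ?case
  proof (cases p)
    case Nil
    then show ?thesis by (simp add: conn_singleton)
  next
    case (Cons y q)
    then show ?thesis
      using Cons.IH Cons.prems conn_Un[OF Cons.prems(1) conn_singleton, of "set p" x x y]
      by (simp add: insert_commute)
  qed
qed (simp add: conn_def)

text \<open>The induced subgraphs on the sets \<open>U i\<close> serve as branch sets, which reduces
  the search for a minor to vertex sets.\<close>

lemma is_minor_complete_natI:
  assumes "pair_bidirected_digraph \<Gamma>"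
    and U: "\<And>i. i < m \<Longrightarrow> finite (U i) \<and> U i \<noteq> {} \<and> U i \<subseteq> pverts \<Gamma> \<and> conn (parcs \<Gamma>) (U i)"
    and disj: "\<And>i j. i < m \<Longrightarrow> j < m \<Longrightarrow> i \<noteq> j \<Longrightarrow> U i \<inter> U j = {}"
    and adj: "\<And>i j. i < m \<Longrightarrow> j < m \<Longrightarrow> i \<noteq> j \<Longrightarrow> \<exists>x\<in>U i. \<exists>y\<in>U j. (x, y) \<in> parcs \<Gamma>"
  shows "is_minor (complete_nat m) \<Gamma>"
proof -
  interpret pair_bidirected_digraph \<Gamma> by fact
  define B where "B i = \<lparr>pverts = U i, parcs = parcs \<Gamma> \<inter> U i \<times> U i\<rparr>" for i
  have B: "pverts (B i) = U i" "parcs (B i) = parcs \<Gamma> \<inter> U i \<times> U i" for i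
    by (simp_all add: B_def)
  have g: "pair_graph (B i)" if "i < m" for i
  proof
    show "symmetric (with_proj (B i))"
      by (auto simp: symmetric_def B intro!: symI arcs_symmetric)
  qed (use U[OF that] pair_no_loops in \<open>auto simp: B\<close>)
  have "subgraph (B i) \<Gamma>" if "i < m" for i
  proof -
    interpret Bi: pair_graph "B i" using g[OF that] .
    show ?thesis
      using U[OF that] wf_digraph Bi.wf_digraph by (auto simp: subgraph_def B)
  qed
  moreover have "Digraph_Component.connected (B i)" if "i < m" for i
    unfolding connected_conv
  proof (intro conjI ballI)
    show "verts (with_proj (B i)) \<noteq> {}" using U[OF that] by (simp add: B)
  next
    fix u v assume uv: "u \<in> verts (with_proj (B i))" "v \<in> verts (with_proj (B i))"
    then have "(u, v) \<in> (parcs \<Gamma> \<inter> U i \<times> U i)\<^sup>*" using U[OF that] by (auto simp: B conn_def)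
    then have "(u, v) \<in> rtrancl_on (U i) ((parcs (B i))\<^sup>s)"
    proof (induction rule: rtrancl_induct)
      case base
      then show ?case using uv by (simp add: B)
    next
      case (step y z)
      then have "(y, z) \<in> (parcs (B i))\<^sup>s" "z \<in> U i" by (auto simp: B symcl_def)
      then show ?case using step.IH by (blast intro: rtrancl_on_into_rtrancl_on)
    qed
    then show "(u, v) \<in> rtrancl_on (verts (with_proj (B i))) ((arcs_ends (with_proj (B i)))\<^sup>s)"
      by (simp add: B)
  qed
  ultimately show ?thesis
    unfolding is_minor_def using g disj adj
    by (intro exI[of _ B]) (auto simp: B complete_nat_def)
qed

context one_ended_cayley
begin

section \<open>Splitting the vertices by parity of their length\<close>

lemma ex_pred:
  assumes "g \<in> carrier G" "len g = Suc n" shows "\<exists>h. near 1 g h \<and> len h = n"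
  using len_Suc[OF assms] near_S by metis

lemma ex_near_even:
  assumes "g \<in> carrier G" shows "\<exists>h. near 1 g h \<and> even (len h) \<and> len h \<le> len g"
proof (cases "even (len g)")
  case True
  then show ?thesis using assms near_refl by blast
next
  case False
  then obtain n where "len g = Suc n" by (cases "len g") auto
  then show ?thesis using ex_pred[OF assms] False by (metis even_Suc le_SucI order_refl)
qed

text \<open>If the length is even and positive, a predecessor is odd. The last bound says that
  rounding costs at most one.\<close>

lemma ex_near_odd:
  assumes "g \<in> carrier G" "0 < len g"
  shows "\<exists>h. near 1 g h \<and> odd (len h) \<and> len h \<le> len g \<and> len g \<le> Suc (len h)"
proof (cases "odd (len g)")
  case True
  then show ?thesis using assms near_refl by (meson le_SucI order_refl)
next
  case False
  then obtain n where "len g = Suc n" using assms(2) by (cases "len g") auto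
  then show ?thesis using ex_pred[OF assms(1)] False by (metis even_Suc le_SucI order_refl)
qed

lemma card_word_ball: "n < card (word_ball n)"
proof -
  have "{..n} \<subseteq> len ` word_ball n"
  proof
    fix k assume "k \<in> {..n}"
    then obtain g where "g \<in> carrier G" "len g = k" "k \<le> n" using ex_len by auto
    then show "k \<in> len ` word_ball n" using word_ball_iff by blast
  qed
  then have "card {..n} \<le> card (word_ball n)"
    using finite_word_ball surj_card_le by blast
  then show ?thesis by simp
qed

text \<open>Step size 3 is what remains of an edge once both ends have been rounded to even length.
  The bound \<open>m\<close> makes the relation finite, as \<open>menger\<close> requires.\<close>

definition even_graph :: "nat \<Rightarrow> 'a rel" where
  "even_graph m = {(u, v). near 3 u v \<and> even (len u) \<and> even (len v) \<and> len u \<le> m \<and> len v \<le> m}"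

lemma finite_even_graph: "finite (even_graph m)"
proof -
  have "even_graph m \<subseteq> {g \<in> carrier G. len g \<le> m} \<times> {g \<in> carrier G. len g \<le> m}"
    by (auto simp: even_graph_def near_def)
  then show ?thesis using finite_len_le finite_subset by blast
qed

lemma walk_even:
  assumes "walk_in (even_graph m) A B p" "A \<subseteq> {u \<in> carrier G. even (len u)}" "x \<in> set p"
  shows "x \<in> carrier G \<and> even (len x)"
proof -
  obtain r s where "p = r @ x # s" using assms(3) by (meson split_list)
  then show ?thesis
    using assms(1,2) by (cases r rule: rev_cases)
      (auto simp: walk_in_def successively_append_iff even_graph_def near_def)
qed

text \<open>If fewer than \<open>k\<close> vertices separated, the elements whose rounding is
  reachable, or lies in the separator, would form a finite set containing a large ball but with all
  its boundary near the separator. The radius \<open>r\<close> does not depend on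
  \<open>R\<close>.\<close>

lemma separator_large:
  "\<exists>r. \<forall>R K. finite K \<longrightarrow> separates (even_graph (R + 3))
     {u \<in> carrier G. even (len u) \<and> len u \<le> r} {u \<in> carrier G. even (len u) \<and> R < len u} K
     \<longrightarrow> k \<le> card K"
proof -
  \<comment> \<open>The size bound doubles as the radius, because a ball of radius \<open>r\<close>
    has more than \<open>r\<close> elements.\<close>
  obtain r where r: "\<And>F. finite F \<Longrightarrow> F \<subseteq> carrier G \<Longrightarrow> card (bdry F) \<le> k * card (word_ball 1) \<Longrightarrow> card F \<le> r"
    using card_le_of_bdry by metis
  define A where "A = {u \<in> carrier G. even (len u) \<and> len u \<le> r}"
  have "k \<le> card K" if K: "finite K"
    and sep: "separates (even_graph (R + 3)) A {u \<in> carrier G. even (len u) \<and> R < len u} K" for R K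
  proof (rule ccontr)
    assume "\<not> k \<le> card K"
    define B where "B = {u \<in> carrier G. even (len u) \<and> R < len u}"
    obtain e where e: "\<And>g. g \<in> carrier G \<Longrightarrow> near 1 g (e g) \<and> even (len (e g)) \<and> len (e g) \<le> len g"
      using ex_near_even by metis
    define X where "X = {v. \<exists>p. walk_in (even_graph (R + 3)) A {v} p \<and> set p \<inter> K = {}}"
    have XE: "v \<in> carrier G \<and> even (len v)" if v: "v \<in> X" for v
    proof -
      obtain p where p: "walk_in (even_graph (R + 3)) A {v} p" using v unfolding X_def by blast
      then have "v \<in> set p" by (auto simp: walk_in_def)
      moreover have "A \<subseteq> {u \<in> carrier G. even (len u)}" by (auto simp: A_def)
      ultimately show ?thesis using walk_even[OF p] by blast
    qed
    have XR: "len v \<le> R" if "v \<in> X" for v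
    proof (rule ccontr)
      assume "\<not> len v \<le> R"
      then have "v \<in> B" using XE[OF that] by (simp add: B_def)
      then have "\<exists>p. walk_in (even_graph (R + 3)) A B p \<and> set p \<inter> K = {}"
        using that walk_in_mono[of _ A "{v}" _ _ A B] by (fastforce simp: X_def)
      then show False using sep by (auto simp: separates_def B_def)
    qed
    have XA: "a \<in> X \<union> K" if "a \<in> A" for a
      using that by (auto simp: X_def walk_in_def intro!: exI[of _ "[a]"])
    have Xstep: "v \<in> X \<union> K" if u: "u \<in> X" and uv: "(u, v) \<in> even_graph (R + 3)" for u v
    proof -
      obtain p where p: "walk_in (even_graph (R + 3)) A {u} p" "set p \<inter> K = {}"
        using u unfolding X_def by blast
      then have "walk_in (even_graph (R + 3)) A {v} (p @ [v])"
        using uv by (auto simp: walk_in_def successively_append_iff)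
      then show ?thesis using p(2) by (auto simp: X_def intro!: exI[of _ "p @ [v]"])
    qed
    \<comment> \<open>Pulling back along the rounding \<open>e\<close> turns a set of even vertices
      into a set to which the isoperimetric bound applies.\<close>
    define F where "F = {g \<in> carrier G. e g \<in> X \<union> K}"
    have "finite X"
      using finite_len_le[of R] by (rule finite_subset[rotated]) (use XE XR in auto)
    moreover have "F \<subseteq> (\<Union>h\<in>X \<union> K. {g. near 1 g h})" using e by (auto simp: F_def)
    ultimately have "finite F"
      using K finite_near by (meson finite_UN finite_UnI finite_subset)
    have "bdry F \<subseteq> (\<Union>h\<in>K. {g. near 1 g h})"
    proof
      fix v assume "v \<in> bdry F"
      then obtain w where w: "v \<in> F" "near 1 v w" "w \<notin> F" by (auto simp: bdry_def)
      then have vw: "v \<in> carrier G" "w \<in> carrier G" by (auto simp: near_def)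
      have "near (1 + 1 + 1) (e v) (e w)"
        using near_trans[OF near_trans[OF near_sym w(2)]] e vw by blast
      then have n3: "near 3 (e v) (e w)" by (simp add: numeral_3_eq_3)
      have "e v \<notin> X"
      proof
        assume X: "e v \<in> X"
        \<comment> \<open>Since \<open>e v\<close> has length at most \<open>R\<close>, a step of
          size 3 respects the bound \<open>R + 3\<close>.\<close>
        then have "(e v, e w) \<in> even_graph (R + 3)"
          using n3 e[OF vw(1)] e[OF vw(2)] XR[OF X] near_len[OF near_sym[OF n3]]
          by (auto simp: even_graph_def)
        then show False using Xstep X w(3) vw by (auto simp: F_def)
      qed
      then show "v \<in> (\<Union>h\<in>K. {g. near 1 g h})" using w(1) e by (auto simp: F_def)
    qed
    then have "card (bdry F) \<le> card (\<Union>h\<in>K. {g. near 1 g h})"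
      using K finite_near by (intro card_mono) auto
    also have "\<dots> \<le> (\<Sum>h\<in>K. card {g. near 1 g h})" using K by (rule card_UN_le)
    also have "\<dots> \<le> card K * card (word_ball 1)"
      using sum_bounded_above[of K "\<lambda>h. card {g. near 1 g h}" "card (word_ball 1)", OF card_near]
      by (simp del: word_ball.simps One_nat_def)
    also have "\<dots> \<le> k * card (word_ball 1)" using \<open>\<not> k \<le> card K\<close> by (intro mult_right_mono) auto
    finally have "card F \<le> r" using r \<open>finite F\<close> by (auto simp: F_def)
    moreover have "word_ball r \<subseteq> F"
    proof
      fix g assume "g \<in> word_ball r"
      then have g: "g \<in> carrier G" "len g \<le> r" using word_ball_carrier word_ball_iff by blast+
      then have "e g \<in> A" using e[OF g(1)] by (auto simp: A_def near_def)
      then show "g \<in> F" using XA g by (auto simp: F_def)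
    qed
    ultimately show False
      using card_word_ball[of r] card_mono[OF \<open>finite F\<close>, of "word_ball r"] by simp
  qed
  then show ?thesis unfolding A_def by blast
qed

text \<open>Take the first vertex of length above \<open>a\<close>: its predecessor has length at
  most \<open>a\<close>, and one step gains at most 3.\<close>

lemma walk_crosses:
  assumes "walk_in (even_graph m) A B p" "\<And>u. u \<in> A \<Longrightarrow> len u \<le> a" "\<And>u. u \<in> B \<Longrightarrow> a < len u"
  shows "\<exists>x\<in>set p. a < len x \<and> len x \<le> a + 3"
proof -
  have "last p \<in> set p" "a < len (last p)" using assms(1,3) by (auto simp: walk_in_def)
  then have "\<exists>x\<in>set p. a < len x" by blast
  then obtain ys x zs where p: "p = ys @ x # zs" "a < len x" "\<forall>y\<in>set ys. \<not> a < len y"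
    using split_list_first_prop[of p "\<lambda>x. a < len x"] by blast
  have "ys \<noteq> []" using p assms(1,2) by (force simp: walk_in_def)
  then have "near 3 (last ys) x" "len (last ys) \<le> a"
    using p assms(1) by (auto simp: walk_in_def successively_append_iff even_graph_def not_less)
  then show ?thesis using p near_len[OF near_sym, of 3 "last ys" x] by force
qed

section \<open>Odd connections and assembly of the minor\<close>

abbreviation near_rel :: "nat \<Rightarrow> 'a rel" where
  "near_rel k \<equiv> {(u, v). near k u v}"

lemma sym_near_rel: "sym (near_rel k)"
  by (auto intro!: symI near_sym)

text \<open>Round every vertex of the path to an odd one; consecutive roundings are at distance at
  most 3. The path stays above \<open>Suc n\<close> because rounding may lower the length by
  one.\<close>

lemma odd_connection:
  assumes "(x, y) \<in> (shell (Suc n) m)\<^sup>*" "x \<in> carrier G" "Suc n < len x" "len x \<le> m"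
  shows "\<exists>Q. finite Q \<and> Q \<subseteq> {g \<in> carrier G. odd (len g) \<and> n < len g \<and> len g \<le> m} \<and>
    conn (near_rel 3) Q \<and> (\<exists>u\<in>Q. near 1 x u) \<and> (\<exists>u\<in>Q. near 1 y u)"
  using assms(1)
proof (induction rule: rtrancl_induct)
  case base
  obtain u where u: "near 1 x u" "odd (len u)" "len u \<le> len x" "len x \<le> Suc (len u)"
    using ex_near_odd[of x] assms by auto
  then have "u \<in> carrier G" by (simp add: near_def)
  then show ?case using u assms by (intro exI[of _ "{u}"]) (auto simp: conn_singleton)
next
  case (step y z)
  then obtain Q where Q: "finite Q" "Q \<subseteq> {g \<in> carrier G. odd (len g) \<and> n < len g \<and> len g \<le> m}"
    "conn (near_rel 3) Q" "\<exists>u\<in>Q. near 1 x u" "\<exists>u\<in>Q. near 1 y u" by blast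
  then obtain u where u: "u \<in> Q" "near 1 y u" by blast
  have yz: "near 1 y z" "Suc n < len z" "len z \<le> m" "z \<in> carrier G"
    using step.hyps by (auto simp: shell_def outer_def near_def)
  obtain w where w: "near 1 z w" "odd (len w)" "len w \<le> len z" "len z \<le> Suc (len w)"
    using ex_near_odd[of z] yz by auto
  have "near (1 + 1 + 1) u w"
    using near_trans[OF near_trans[OF near_sym[OF u(2)] yz(1)] w(1)] .
  then have "near 3 u w" by (simp add: numeral_3_eq_3)
  then have "conn (near_rel 3) (Q \<union> {w})"
    using u Q by (intro conn_Un[of _ _ _ u w] sym_near_rel conn_singleton) auto
  moreover have "w \<in> carrier G" using w by (simp add: near_def)
  ultimately show ?case
    using Q w yz by (intro exI[of _ "Q \<union> {w}"]) auto
qed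

lemma complete_minor: "is_minor (complete_nat k) (Cay G (ball_generators 3))"
proof -
  obtain r0 where r0: "\<And>R K. finite K \<Longrightarrow> separates (even_graph (R + 3))
     {u \<in> carrier G. even (len u) \<and> len u \<le> r0} {u \<in> carrier G. even (len u) \<and> R < len u} K
     \<Longrightarrow> k \<le> card K"
    using separator_large[of k] by blast
  obtain A M where AM: "\<And>n. n \<le> A n \<and> A n + 3 \<le> M n"
    "\<And>n x y. x \<in> carrier G \<Longrightarrow> y \<in> carrier G \<Longrightarrow> A n < len x \<Longrightarrow> len x \<le> A n + 3 \<Longrightarrow>
      A n < len y \<Longrightarrow> len y \<le> A n + 3 \<Longrightarrow> (x, y) \<in> (shell n (M n))\<^sup>*"
    using ex_shell by metis
  \<comment> \<open>The successor leaves room for the unit lost in rounding to odd length.\<close>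
  define r where "r l = ((\<lambda>n. M (Suc n)) ^^ l) r0" for l
  have r: "r 0 = r0" "r (Suc l) = M (Suc (r l))" for l by (simp_all add: r_def)
  have rA: "r l < A (Suc (r l))" "A (Suc (r l)) + 3 \<le> r (Suc l)" for l
    using AM(1)[of "Suc (r l)"] by (auto simp: r)
  have "mono r"
  proof (rule mono_iff_le_Suc[THEN iffD2, rule_format])
    show "r l \<le> r (Suc l)" for l using rA[of l] by linarith
  qed
  \<comment> \<open>One shell is provided for each ordered pair of paths; the pair \<open>i\<close>,
    \<open>j\<close> uses the one with index \<open>i * k + j\<close>.\<close>
  define R where "R = r (k * k)"
  define U where "U = {u \<in> carrier G. even (len u) \<and> len u \<le> r0}"
  define W where "W = {u \<in> carrier G. even (len u) \<and> R < len u}"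
  have "\<exists>P. (\<forall>i<k. walk_in (even_graph (R + 3)) U W (P i)) \<and>
    (\<forall>i<k. \<forall>j<k. i \<noteq> j \<longrightarrow> set (P i) \<inter> set (P j) = {})"
    using r0 by (intro menger finite_even_graph) (auto simp: U_def W_def)
  then obtain P where P: "\<And>i. i < k \<Longrightarrow> walk_in (even_graph (R + 3)) U W (P i)"
    "\<And>i j. i < k \<Longrightarrow> j < k \<Longrightarrow> i \<noteq> j \<Longrightarrow> set (P i) \<inter> set (P j) = {}" by blast
  have PE: "x \<in> carrier G \<and> even (len x)" if "i < k" "x \<in> set (P i)" for i x
  proof -
    have "U \<subseteq> {u \<in> carrier G. even (len u)}" by (auto simp: U_def)
    then show ?thesis using walk_even[OF P(1)] that by blast
  qed
  have Pconn: "conn (near_rel 3) (set (P i))" if "i < k" for i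
    using P(1)[OF that]
    by (intro conn_walk sym_near_rel) (auto simp: walk_in_def even_graph_def elim!: successively_mono)
  have "\<exists>x\<in>set (P i). A (Suc (r l)) < len x \<and> len x \<le> A (Suc (r l)) + 3" if "i < k" "l < k * k" for i l
  proof (rule walk_crosses[OF P(1)[OF that(1)]])
    show "len u \<le> A (Suc (r l))" if "u \<in> U" for u
      using that rA(1)[of l] monoD[OF \<open>mono r\<close>, of 0 l] by (simp add: U_def r)
    show "A (Suc (r l)) < len u" if "u \<in> W" for u
      using that rA(2)[of l] monoD[OF \<open>mono r\<close>, of "Suc l" "k * k"] \<open>l < k * k\<close> by (simp add: W_def R_def)
  qed
  then obtain x where x: "\<And>i l. i < k \<Longrightarrow> l < k * k \<Longrightarrow>
      x i l \<in> set (P i) \<and> A (Suc (r l)) < len (x i l) \<and> len (x i l) \<le> A (Suc (r l)) + 3"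
    by metis
  have code: "i * k + j < k * k" if "i < k" "j < k" for i j
  proof -
    have "i * k + j < Suc i * k" using that by simp
    also have "\<dots> \<le> k * k" using that by (intro mult_right_mono) auto
    finally show ?thesis .
  qed
  define links where "links i j Q \<longleftrightarrow> finite Q \<and>
    Q \<subseteq> {g \<in> carrier G. odd (len g) \<and> r (i * k + j) < len g \<and> len g \<le> r (Suc (i * k + j))} \<and>
    conn (near_rel 3) Q \<and> (\<exists>u\<in>Q. near 1 (x i (i * k + j)) u) \<and> (\<exists>u\<in>Q. near 1 (x j (i * k + j)) u)"
    for i j Q
  have "\<exists>Q. links i j Q"
    if "i < k" "j < k" for i j
  proof -
    define l where "l = i * k + j"
    have l: "l < k * k" using code that by (simp add: l_def)
    have xi: "x i l \<in> carrier G" "x j l \<in> carrier G" using x[OF _ l] PE that by blast+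
    have "(x i l, x j l) \<in> (shell (Suc (r l)) (M (Suc (r l))))\<^sup>*"
      using AM(2)[OF xi] x[OF that(1) l] x[OF that(2) l] by blast
    then show ?thesis
      using odd_connection[of "x i l" "x j l" "r l" "r (Suc l)"] xi x[OF that(1) l]
        AM(1)[of "Suc (r l)"] by (auto simp: r l_def links_def)
  qed
  then obtain Q where "\<And>i j. i < k \<Longrightarrow> j < k \<Longrightarrow> links i j (Q i j)" by metis
  note Q = this[unfolded links_def]
  \<comment> \<open>Path \<open>i\<close> absorbs the whole connections \<open>Q i j\<close>; each
    then only has to be adjacent to path \<open>j\<close>.\<close>
  define V where "V i = set (P i) \<union> (\<Union>j<k. Q i j)" for i
  have QQ: "Q i j \<inter> Q i' j' = {}" if "i < k" "j < k" "i' < k" "j' < k" "i \<noteq> i'" for i j i' j'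
  proof -
    \<comment> \<open>Division by \<open>k\<close> recovers the row, so different rows use different
      shells.\<close>
    have "(i * k + j) div k \<noteq> (i' * k + j') div k" using that by simp
    then have "i * k + j < i' * k + j' \<or> i' * k + j' < i * k + j" by (metis nat_neq_iff)
    then have "r (Suc (i * k + j)) \<le> r (i' * k + j') \<or> r (Suc (i' * k + j')) \<le> r (i * k + j)"
      using monoD[OF \<open>mono r\<close>] by (metis Suc_leI)
    then show ?thesis using Q[OF that(1,2)] Q[OF that(3,4)] by fastforce
  qed
  have PQ: "set (P i) \<inter> Q i' j = {}" if "i < k" "i' < k" "j < k" for i i' j
    using PE[OF that(1)] Q[OF that(2,3)] by blast
  have disj: "V i \<inter> V j = {}" if "i < k" "j < k" "i \<noteq> j" for i j
  proof -
    have "set (P i) \<inter> set (P j) = {}" using P(2) that by blast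
    moreover have "set (P i) \<inter> (\<Union>l<k. Q j l) = {}" "set (P j) \<inter> (\<Union>l<k. Q i l) = {}"
      using PQ that by blast+
    moreover have "(\<Union>l<k. Q i l) \<inter> (\<Union>l<k. Q j l) = {}" using QQ that by blast
    ultimately show ?thesis
      unfolding V_def Int_Un_distrib Int_Un_distrib2 by (simp add: Int_commute)
  qed
  let ?\<Gamma> = "Cay G (ball_generators 3)"
  have parcs: "parcs ?\<Gamma> = near_rel 3 - Id" by (auto simp: parcs_Cay_ball)
  show ?thesis
  proof (rule is_minor_complete_natI[of _ _ V])
    show "pair_bidirected_digraph ?\<Gamma>"
      by (intro pair_bidirected_digraph_Cay is_group cayley_generators_ball) simp
    show "V i \<inter> V j = {}" if "i < k" "j < k" "i \<noteq> j" for i j using disj that .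
    show "finite (V i) \<and> V i \<noteq> {} \<and> V i \<subseteq> pverts ?\<Gamma> \<and> conn (parcs ?\<Gamma>) (V i)" if i: "i < k" for i
    proof (intro conjI)
      show "finite (V i)" using Q i by (auto simp: V_def)
      show "V i \<noteq> {}" using P(1)[OF i] by (auto simp: V_def walk_in_def)
      have "set (P i) \<subseteq> carrier G" using PE i by blast
      moreover have "(\<Union>j<k. Q i j) \<subseteq> carrier G" using Q i by blast
      ultimately show "V i \<subseteq> pverts ?\<Gamma>" by (simp add: V_def Cay_def)
      have "conn (near_rel 3) (V i)"
        unfolding V_def
      proof (intro conn_UN sym_near_rel Pconn i)
        fix j assume j: "j \<in> {..<k}"
        then obtain u where "u \<in> Q i j" "near 1 (x i (i * k + j)) u" using Q[OF i, of j] by auto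
        moreover have "x i (i * k + j) \<in> set (P i)" using x[OF i code[OF i, of j]] j by simp
        ultimately show "conn (near_rel 3) (Q i j) \<and> (\<exists>u\<in>set (P i). \<exists>v\<in>Q i j. (u, v) \<in> near_rel 3)"
          using Q[OF i, of j] j near_mono[of 1 _ _ 3] by auto
      qed simp
      moreover have "(near_rel 3 - Id) \<inter> V i \<times> V i = (near_rel 3 \<inter> V i \<times> V i) - Id" by blast
      ultimately show "conn (parcs ?\<Gamma>) (V i)"
        unfolding conn_def parcs by (simp only: rtrancl_r_diff_Id)
    qed
    \<comment> \<open>The far end of \<open>Q i j\<close> is near path \<open>j\<close>;
      disjointness of the branch sets excludes a loop.\<close>
    show "\<exists>u\<in>V i. \<exists>v\<in>V j. (u, v) \<in> parcs ?\<Gamma>" if ij: "i < k" "j < k" "i \<noteq> j" for i j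
    proof -
      obtain u where u: "u \<in> Q i j" "near 1 (x j (i * k + j)) u" using Q[OF ij(1,2)] by blast
      have "u \<in> V i" using u that by (auto simp: V_def)
      moreover have "x j (i * k + j) \<in> V j" using x[OF that(2) code[OF that(1,2)]] by (simp add: V_def)
      moreover have "near 3 u (x j (i * k + j))" using near_sym[OF u(2)] by (rule near_mono) simp
      ultimately show ?thesis using disj[OF that] unfolding parcs by blast
    qed
  qed
qed

end

theorem theorem3p10:
  fixes G :: "('a, 'm) monoid_scheme"
  assumes "group G"
    and "finitely_generated G"
    and "group_has_ends G 1"
  shows "\<exists>S. cayley_generators G S \<and> \<not> minor_excluded (Cay G S)"
proof -
  obtain S where S: "cayley_generators G S" "has_ends (Cay G S) \<one>\<^bsub>G\<^esub> 1"
    using assms(3) by (auto simp: group_has_ends_def)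
  interpret group G by fact
  interpret one_ended_cayley G S by unfold_locales (rule S)+
  \<comment> \<open>The same generators give complete minors of every order.\<close>
  have "\<not> minor_excluded (Cay G (ball_generators 3))"
    using complete_minor by (simp add: minor_excluded_iff_complete)
  then show ?thesis using cayley_generators_ball[of 3] by auto
qed

end
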